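(* Let $0<\beta\le\alpha\le1$, $0<\theta\le1$, $[0,T]\subset[0,1]$, and let $F=(F_{ij}):\mathbb{R}_+\times\mathbb{R}^m\times\mathbb{R}^d\to\mathcal{L}(\mathbb{R}^d,\mathbb{R}^m)$ have continuous components $F_{ij}$ that are $\theta$-Hölder in $t$, $y$ and $x_k$ ($k\ne j$), locally uniformly in $x_j$. If $\gamma>0$ and $0<\beta-\gamma<\beta_0<\theta\beta$, then for every $x\in G_{\beta_0,\gamma}([0,T])\cap H_\alpha([0,T],\mathbb{R}^d)$ and every $y_0\in\mathbb{R}^m$ there exists a solution $y\in H_\beta([0,T],\mathbb{R}^m)$ of $$dy(t)=F(t,y(t),x(t))\,dx(t),\quad y(0)=y_0,\quad t\in[0,T].$$
   Context: $H_\alpha([0,T],\mathbb{R}^d)$ is the class of $\alpha$-Hölder maps $[0,T]\to\mathbb{R}^d$. "$F_{ij}$ is $\theta$-Hölder in $t,y,x_k$ ($k\neq j$), locally uniformly in $x_j$" means: for every compact $K\subset\mathbb{R}$ there is $L<\infty$ with $|F_{ij}(t,y,x)-F_{ij}(t',y',x')|\le L(|t-t'|^\theta+|y-y'|^\theta+|x-x'|^\theta)$ for all $t,t'\in[0,1]$, $y,y'\in\mathbb{R}^m$, $x,x'\in\mathbb{R}^d$ with $x_j=x'_j\in K$. Integral: put $t_{k,n}=n2^{-k}$ and, for a continuous real function $g$ on $[0,T]$, $h_{k,n}=h_{k,n}(g)=2^k\int_{t_{k,n}}^{t_{k,n+1}}g(\tau)\,d\tau$ when $[t_{k,n},t_{k,n+1}]\subset[0,T]$.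 For $0\le a<b\le T$, $k\ge1$, let $n_k(a)$, $n_k(b)$ be the smallest and largest element of $\{n:0\le n\le2^k,\ [t_{k-1,\lfloor n/2\rfloor},t_{k-1,\lfloor n/2\rfloor+1}]\subset[a,b]\}$ (empty sums are $0$). For continuous $f$, $$\int_a^bf(t,g(t))\,dg(t)=\lim_{k\to\infty}\sum_{n=n_k(a)+1}^{n_k(b)}\int_{h_{k,n-1}}^{h_{k,n}}f(t_{k,n},\xi)\,d\xi,$$ if the limit exists (finite). For vector paths, $\int_a^bF(u,y(u),x(u))\,dx(u)$ is the $m$-vector with $i$-th entry $\sum_{j=1}^d\int_a^bF_{ij}(u,y(u),x(u))\,dx_j(u)$, where the $j$-th term is the integral $\int_a^bf(t,g(t))\,dg(t)=\lim_{k\to\infty}\sum_{n=n_k(a)+1}^{n_k(b)}\int_{h_{k,n-1}(g)}^{h_{k,n}(g)}f(t_{k,n},\xi)\,d\xi$ with $g=x_j$ and $f(t,\xi)=F_{ij}(t,y(t),x_1(t),\dots,x_{j-1}(t),\xi,x_{j+1}(t),\dots,x_d(t))$. A solution of the equation is a function $y\in H_\beta([0,T],\mathbb{R}^m)$ with $y(t)=y_0+\int_0^tF(u,y(u),x(u))\,dx(u)$ for $t\in[0,T]$ (the integrals existing). Class $G_{\beta,\gamma}([0,T])$ ($\beta,\gamma>0$): the set of $x\in C([0,T],\mathbb{R}^d)$ with $$|x,G_{\beta,\gamma}([0,T])|=\sup_{0\le a<b\le T,\ 1\le j\le d}\frac{\mu(x_j,a,b,\beta)}{(b-a)^{\beta+\gamma}}<\infty,$$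 $$\mu(g,a,b,\beta)=\sum_{k=k_0+1}^\infty2^{-(k+1)\beta}\sum_{n:\,[t_{k,n-1},t_{k,n}]\subset[a,b]}|h_{k+1,2(n-1)}(g)-h_{k+1,2(n-1)+1}(g)|,$$ where $k_0=\lfloor\log_2(2/(b-a))\rfloor$ (so that $2^{-k_0-1}\le b-a\le2^{-k_0+1}$). *)

theory Defs
  imports "HOL-Analysis.Analysis"
begin

text \<open>
  Paths on \<open>[0,T]\<close> are total functions on \<open>real\<close>; every notion below looks at them on
  \<open>[0,T]\<close> only. Here and in the main theorem \<open>[0,T]\<close> is contained in \<open>[0,1]\<close>.
\<close>

definition dyadic :: "nat \<Rightarrow> nat \<Rightarrow> real" where
  "dyadic k n = real n / 2 ^ k"

text \<open>The local average is used only when its dyadic interval lies in \<open>[0,T]\<close>.\<close>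

definition avg :: "(real \<Rightarrow> real) \<Rightarrow> nat \<Rightarrow> nat \<Rightarrow> real" where
  "avg g k n = 2 ^ k * integral {dyadic k n..dyadic k (n + 1)} g"

definition holder_class :: "real \<Rightarrow> real \<Rightarrow> (real \<Rightarrow> 'a::real_normed_vector) set" where
  "holder_class \<alpha> T =
     {f. \<exists>C. \<forall>s\<in>{0..T}. \<forall>t\<in>{0..T}. norm (f s - f t) \<le> C * \<bar>s - t\<bar> powr \<alpha>}"

definition holder_except ::
    "real \<Rightarrow> 'd::finite \<Rightarrow> (real \<Rightarrow> real ^ 'm::finite \<Rightarrow> real ^ 'd \<Rightarrow> real) \<Rightarrow> bool" where
  "holder_except \<theta> j \<phi> \<longleftrightarrow>
     (\<forall>K :: real set. compact K \<longrightarrow>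
       (\<exists>L. \<forall>t\<in>{0..1}. \<forall>t'\<in>{0..1}. \<forall>y y' x x'.
          x $ j = x' $ j \<and> x $ j \<in> K \<longrightarrow>
          \<bar>\<phi> t y x - \<phi> t' y' x'\<bar>
            \<le> L * (\<bar>t - t'\<bar> powr \<theta> + norm (y - y') powr \<theta> + norm (x - x') powr \<theta>)))"

text \<open>
  \<open>Min\<close> and \<open>Max\<close> of \<open>level_indices a b k\<close> are the \<open>n\<^sub>k(a)\<close> and \<open>n\<^sub>k(b)\<close> of the integral.
  Only levels \<open>k \<ge> 1\<close> are meaningful; level \<open>0\<close> (where \<open>k - 1\<close> truncates) does not affect
  the limit.
\<close>

definition level_indices :: "real \<Rightarrow> real \<Rightarrow> nat \<Rightarrow> nat set" where
  "level_indices a b k =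
     {n. n \<le> 2 ^ k \<and> {dyadic (k - 1) (n div 2)..dyadic (k - 1) (n div 2 + 1)} \<subseteq> {a..b}}"

definition level_sum ::
    "(real \<Rightarrow> real \<Rightarrow> real) \<Rightarrow> (real \<Rightarrow> real) \<Rightarrow> real \<Rightarrow> real \<Rightarrow> nat \<Rightarrow> real" where
  "level_sum f g a b k =
     (if level_indices a b k = {} then 0
      else \<Sum>n = Min (level_indices a b k) + 1..Max (level_indices a b k).
             LBINT \<xi>=avg g k (n - 1)..avg g k n. f (dyadic k n) \<xi>)"

text \<open>
  For \<open>a = b\<close> all level sums vanish, so the integral exists and is \<open>0\<close>.
\<close>

definition path_integrable ::
    "(real \<Rightarrow> real \<Rightarrow> real) \<Rightarrow> (real \<Rightarrow> real) \<Rightarrow> real \<Rightarrow> real \<Rightarrow> bool" where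
  "path_integrable f g a b \<longleftrightarrow> convergent (level_sum f g a b)"

definition path_integral ::
    "(real \<Rightarrow> real \<Rightarrow> real) \<Rightarrow> (real \<Rightarrow> real) \<Rightarrow> real \<Rightarrow> real \<Rightarrow> real" where
  "path_integral f g a b = lim (level_sum f g a b)"

text \<open>
  The scalar integrand of \<open>F\<^sub>i\<^sub>j(u, y(u), x(u)) dx\<^sub>j(u)\<close>: the \<open>j\<close>-th coordinate of the
  driving path is replaced by the free variable \<open>\<xi>\<close>.
\<close>

definition component_integrand ::
    "(real \<Rightarrow> real ^ 'm::finite \<Rightarrow> real ^ 'd::finite \<Rightarrow> real ^ 'd ^ 'm) \<Rightarrow>
     (real \<Rightarrow> real ^ 'm) \<Rightarrow> (real \<Rightarrow> real ^ 'd) \<Rightarrow> 'm \<Rightarrow> 'd \<Rightarrow> real \<Rightarrow> real \<Rightarrow> real" where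
  "component_integrand F y x i j t \<xi> =
     F t (y t) (\<chi> l. if l = j then \<xi> else x t $ l) $ i $ j"

definition vector_path_integrable ::
    "(real \<Rightarrow> real ^ 'm::finite \<Rightarrow> real ^ 'd::finite \<Rightarrow> real ^ 'd ^ 'm) \<Rightarrow>
     (real \<Rightarrow> real ^ 'm) \<Rightarrow> (real \<Rightarrow> real ^ 'd) \<Rightarrow> real \<Rightarrow> real \<Rightarrow> bool" where
  "vector_path_integrable F y x a b \<longleftrightarrow>
     (\<forall>i j. path_integrable (component_integrand F y x i j) (\<lambda>t. x t $ j) a b)"

definition vector_path_integral ::
    "(real \<Rightarrow> real ^ 'm::finite \<Rightarrow> real ^ 'd::finite \<Rightarrow> real ^ 'd ^ 'm) \<Rightarrow>
     (real \<Rightarrow> real ^ 'm) \<Rightarrow> (real \<Rightarrow> real ^ 'd) \<Rightarrow> real \<Rightarrow> real \<Rightarrow> real ^ 'm" where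
  "vector_path_integral F y x a b =
     (\<chi> i. \<Sum>j\<in>UNIV. path_integral (component_integrand F y x i j) (\<lambda>t. x t $ j) a b)"

definition is_solution ::
    "(real \<Rightarrow> real ^ 'm::finite \<Rightarrow> real ^ 'd::finite \<Rightarrow> real ^ 'd ^ 'm) \<Rightarrow>
     (real \<Rightarrow> real ^ 'd) \<Rightarrow> real ^ 'm \<Rightarrow> real \<Rightarrow> real \<Rightarrow> (real \<Rightarrow> real ^ 'm) \<Rightarrow> bool" where
  "is_solution F x y0 \<beta> T y \<longleftrightarrow>
     y \<in> holder_class \<beta> T \<and>
     (\<forall>t\<in>{0..T}. vector_path_integrable F y x 0 t \<and>
                  y t = y0 + vector_path_integral F y x 0 t)"

text \<open>
  The series defining \<open>\<mu>\<close> has nonnegative terms and may diverge, hence the type \<open>ennreal\<close>.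
  Since \<open>0 < b - a \<le> 1\<close>, the logarithm is at least \<open>1\<close> and \<open>nat\<close> does not truncate. The
  variable \<open>i\<close> shifts the series to start at \<open>k = k\<^sub>0 + 1\<close>.
\<close>

definition mu :: "(real \<Rightarrow> real) \<Rightarrow> real \<Rightarrow> real \<Rightarrow> real \<Rightarrow> ennreal" where
  "mu g a b \<beta> =
     (let k0 = nat \<lfloor>log 2 (2 / (b - a))\<rfloor> in
      \<Sum>i. let k = k0 + 1 + i in
        ennreal (2 powr (- (real (k + 1) * \<beta>)) *
          (\<Sum>n | 1 \<le> n \<and> {dyadic k (n - 1)..dyadic k n} \<subseteq> {a..b}.
             \<bar>avg g (k + 1) (2 * (n - 1)) - avg g (k + 1) (2 * (n - 1) + 1)\<bar>)))"

definition G_norm :: "real \<Rightarrow> real \<Rightarrow> real \<Rightarrow> (real \<Rightarrow> real ^ 'd::finite) \<Rightarrow> ennreal" where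
  "G_norm \<beta> \<gamma> T x =
     (SUP (a, b, j) \<in> {(a, b, j). 0 \<le> a \<and> a < b \<and> b \<le> T}.
        mu (\<lambda>t. x t $ j) a b \<beta> / ennreal ((b - a) powr (\<beta> + \<gamma>)))"

definition G_class :: "real \<Rightarrow> real \<Rightarrow> real \<Rightarrow> (real \<Rightarrow> real ^ 'd::finite) set" where
  "G_class \<beta> \<gamma> T = {x. continuous_on {0..T} x \<and> G_norm \<beta> \<gamma> T x < \<infinity>}"

end

theory Submission
  imports Defs "HOL-Complex_Analysis.Great_Picard"
begin

text \<open>
  A level sum freezes the integrand at dyadic times and integrates it over the jumps between
  consecutive dyadic averages of the driver. Passing from level \<open>k\<close> to level \<open>k + 1\<close> refines every
  average into the averages of its two children, and changes only the time at which the integrand is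
  frozen on the way from child to parent, by \<open>2 powr -(k + 1)\<close> (\<open>jump_sum_refine\<close>). If the integrand is
  \<open>\<rho>\<close>-Hoelder in time, the level sum therefore changes by at most \<open>2 powr (-(k + 1) * \<rho>)\<close> times the
  dyadic variation of the driver at level \<open>k\<close>, up to a bounded number of boundary terms that are small
  because the driver is \<open>\<alpha>\<close>-Hoelder (\<open>level_increment_step\<close>). The \<open>G\<close>-norm bounds the dyadic
  variations with the weights \<open>2 powr (-(k + 1) * \<beta>\<^sub>0)\<close>, so for \<open>\<rho> > \<beta>\<^sub>0\<close> the changes sum up.

  For a \<open>\<beta>\<close>-Hoelder path \<open>y\<close> the component integrands have \<open>\<rho> = \<theta> * \<beta>\<close>. The integrals thus exist, with
  a convergence rate that depends only on bounds for \<open>y\<close>, and the increment of the integral over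
  \<open>{a..b}\<close> is at most a constant times
  \<open>(1 + N) * (b - a) powr \<beta> + (1 + M) * (b - a) powr (\<theta> * \<beta> + \<gamma>)\<close>, where \<open>N\<close> is the sup norm and \<open>M\<close> the
  Hoelder constant of \<open>y\<close> (\<open>vector_integral_increment\<close>). The hypotheses on the exponents say that
  \<open>\<rho> > \<beta>\<^sub>0\<close> and imply \<open>\<theta> * \<beta> + \<gamma> > \<beta>\<close>. So on intervals shorter than some \<open>\<delta>\<close>,
  which does not depend on \<open>y\<close>, the Hoelder constant of the integral is at most a multiple of
  \<open>1 + N\<close> plus a small multiple of \<open>1 + M\<close>, and a class of paths with exponentially growing bounds is mapped into itself
  (\<open>picard_tempered\<close>).

  The integrand need not be Lipschitz in \<open>y\<close>, so no contraction is available, and the solution is found by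
  compactness. In the equation with a small delay the integrand uses the past of \<open>y\<close> only, hence
  the iteration of the integral operator becomes stationary and solves that equation exactly
  (\<open>tonelli_stabilises\<close>). The solutions with delay \<open>1 / (n + 1)\<close> all lie in the invariant class, which is
  equicontinuous; a subsequence converges by the Arzela-Ascoli theorem. The uniform convergence rate
  of the level sums makes the integral operator continuous on the class (\<open>picard_continuous\<close>), so
  the limit solves the equation.
\<close>

section \<open>Dyadic level sums and their refinement\<close>

lemma half_power_powr: "(1 / 2 ^ k :: real) powr r = 2 powr (- (real k * r))"
  by (simp add: powr_minus powr_powr divide_inverse inverse_powr flip: powr_realpow)

text \<open>
  Only the differences of a primitive \<open>\<Phi> t\<close> of \<open>f t\<close> enter a level sum, so all estimates on level
  sums are made for a function \<open>\<Phi>\<close> of two variables. The integrand itself comes back only when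
  \<open>\<Phi>\<close> is taken to be the primitive of \<open>f\<close>.
\<close>

definition jump_sum :: "(real \<Rightarrow> real \<Rightarrow> real) \<Rightarrow> (real \<Rightarrow> real) \<Rightarrow> nat \<Rightarrow> nat \<Rightarrow> real" where
  "jump_sum \<Phi> g k N =
     (\<Sum>n\<in>{1..<N}. \<Phi> (dyadic k n) (avg g k n) - \<Phi> (dyadic k n) (avg g k (n - 1)))"

text \<open>
  The inner sum of \<open>mu\<close>: the level-\<open>k\<close> part of the variation of the path, measured by the
  oscillation of the averages inside each dyadic interval.
\<close>

definition dyadic_variation :: "(real \<Rightarrow> real) \<Rightarrow> real \<Rightarrow> real \<Rightarrow> nat \<Rightarrow> real" where
  "dyadic_variation g a b k =
     (\<Sum>n | 1 \<le> n \<and> {dyadic k (n - 1)..dyadic k n} \<subseteq> {a..b}.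
        \<bar>avg g (k + 1) (2 * (n - 1)) - avg g (k + 1) (2 * (n - 1) + 1)\<bar>)"

text \<open>
  What a primitive inherits from an integrand that is bounded by \<open>B\<close> and \<open>\<rho>\<close>-Hoelder in time with
  constant \<open>\<Lambda>\<close>. The Hoelder bound is asked for at time distances up to \<open>\<eta>\<close> only: an increment of
  the integral over an interval of length \<open>\<eta>\<close> sees no larger distance, and the a priori estimate
  below has good constants only for small ones.
\<close>

definition controlled_primitive ::
    "(real \<Rightarrow> real \<Rightarrow> real) \<Rightarrow> real \<Rightarrow> real \<Rightarrow> real \<Rightarrow> real \<Rightarrow> real \<Rightarrow> real \<Rightarrow> bool" where
  "controlled_primitive \<Phi> b \<eta> R B \<Lambda> \<rho> \<longleftrightarrow>
     (\<forall>t\<in>{0..b}. \<forall>u\<in>{-R..R}. \<forall>v\<in>{-R..R}. \<bar>\<Phi> t u - \<Phi> t v\<bar> \<le> B * \<bar>u - v\<bar>) \<and>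
     (\<forall>s\<in>{0..b}. \<forall>t\<in>{0..b}. \<bar>s - t\<bar> \<le> \<eta> \<longrightarrow> (\<forall>u\<in>{-R..R}. \<forall>v\<in>{-R..R}.
        \<bar>(\<Phi> s u - \<Phi> s v) - (\<Phi> t u - \<Phi> t v)\<bar> \<le> \<Lambda> * \<bar>s - t\<bar> powr \<rho> * \<bar>u - v\<bar>))"

lemma dyadic_nonneg [simp]: "0 \<le> dyadic k n"
  by (simp add: dyadic_def)

lemma dyadic_mono: "m \<le> n \<Longrightarrow> dyadic k m \<le> dyadic k n"
  by (simp add: dyadic_def divide_right_mono)

lemma dyadic_double: "dyadic (k + 1) (2 * n) = dyadic k n"
  by (simp add: dyadic_def)

lemma dyadic_le_iff: "dyadic k n \<le> t \<longleftrightarrow> real n \<le> t * 2 ^ k"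
  by (simp add: dyadic_def field_simps)

lemma dyadic_add: "dyadic k (m + n) = dyadic k m + real n / 2 ^ k"
  by (simp add: dyadic_def add_divide_distrib)

text \<open>
  Inside the dyadic interval \<open>n\<close> of level \<open>k\<close> the finer sum moves from the left child average \<open>p\<close> to
  the right one \<open>q\<close> with the integrand frozen at the midpoint. The coarser sum makes the same move
  through the parent average \<open>h\<close>, with the integrand frozen at the left end up to \<open>h\<close> and at the
  right end after \<open>h\<close>. This is the difference of the two.
\<close>

definition refine_defect :: "(real \<Rightarrow> real \<Rightarrow> real) \<Rightarrow> (real \<Rightarrow> real) \<Rightarrow> nat \<Rightarrow> nat \<Rightarrow> real" where
  "refine_defect \<Phi> g k n =
     (let p = avg g (k + 1) (2 * n); q = avg g (k + 1) (2 * n + 1); h = avg g k n; s = dyadic (k + 1) (2 * n + 1)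
      in (\<Phi> s q - \<Phi> s p) - (\<Phi> (dyadic k n) h - \<Phi> (dyadic k n) p)
         - (\<Phi> (dyadic k (n + 1)) q - \<Phi> (dyadic k (n + 1)) h))"

text \<open>
  The move from the parent average to the last child average that the finer sum has made in
  addition when both sums stop at \<open>dyadic k n\<close>. For \<open>n = 0\<close> the truncated subtractions give the
  move at the start of the path, with the sign that makes the telescoping below uniform in \<open>n\<close>.
\<close>

definition end_defect :: "(real \<Rightarrow> real \<Rightarrow> real) \<Rightarrow> (real \<Rightarrow> real) \<Rightarrow> nat \<Rightarrow> nat \<Rightarrow> real" where
  "end_defect \<Phi> g k n =
     \<Phi> (dyadic k n) (avg g (k + 1) (2 * n - 1)) - \<Phi> (dyadic k n) (avg g k (n - 1))"

lemma jump_sum_Suc: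
  "jump_sum \<Phi> g k (Suc N) = jump_sum \<Phi> g k N
     + (if N = 0 then 0 else \<Phi> (dyadic k N) (avg g k N) - \<Phi> (dyadic k N) (avg g k (N - 1)))"
  by (cases "N = 0") (auto simp: jump_sum_def)

text \<open>
  Between two dyadic intervals the integrand is frozen at the same time in both sums: the finer
  one uses \<open>dyadic (k + 1) (2 * n)\<close>, which is \<open>dyadic k n\<close>. Hence these moves agree once they are
  measured from parent to parent, and only the defects inside the intervals and at the two ends
  remain.
\<close>

lemma jump_sum_refine:
  assumes "M \<le> N"
  shows "(jump_sum \<Phi> g (k + 1) (2 * N) - jump_sum \<Phi> g k N)
       - (jump_sum \<Phi> g (k + 1) (2 * M) - jump_sum \<Phi> g k M)
       = (\<Sum>n\<in>{M..<N}. refine_defect \<Phi> g k n) + end_defect \<Phi> g k N - end_defect \<Phi> g k M"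
  using assms
proof (induction N rule: dec_induct)
  case base
  show ?case by simp
next
  case (step N)
  have "jump_sum \<Phi> g (k + 1) (2 * Suc N) - jump_sum \<Phi> g k (Suc N)
      = jump_sum \<Phi> g (k + 1) (2 * N) - jump_sum \<Phi> g k N
        + refine_defect \<Phi> g k N + end_defect \<Phi> g k (Suc N) - end_defect \<Phi> g k N"
    using dyadic_double[of k N]
    by (cases "N = 0") (simp_all add: jump_sum_Suc refine_defect_def end_defect_def Let_def numeral_2_eq_2)
  then show ?case using step by simp
qed

text \<open>
  The level sum over \<open>{0..t}\<close>. It stops with the last pair of sibling intervals whose parent fits
  into \<open>{0..t}\<close>. Sums over \<open>{a..b}\<close> are replaced by the differences of these sums, which
  makes additivity of the integral trivial.
\<close>

definition running_sum :: "(real \<Rightarrow> real \<Rightarrow> real) \<Rightarrow> (real \<Rightarrow> real) \<Rightarrow> real \<Rightarrow> nat \<Rightarrow> real" where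
  "running_sum \<Phi> g t k = jump_sum \<Phi> g k (2 * nat \<lfloor>t * 2 ^ (k - 1)\<rfloor>)"

lemma dyadic_floor_le: "0 \<le> t \<Longrightarrow> dyadic k (nat \<lfloor>t * 2 ^ k\<rfloor>) \<le> t"
  by (simp add: dyadic_le_iff)

lemma dyadic_floor_parity:
  fixes t :: real
  assumes "0 \<le> t" "1 \<le> k"
  shows "nat \<lfloor>t * 2 ^ k\<rfloor> = 2 * nat \<lfloor>t * 2 ^ (k - 1)\<rfloor>
       \<or> nat \<lfloor>t * 2 ^ k\<rfloor> = 2 * nat \<lfloor>t * 2 ^ (k - 1)\<rfloor> + 1"
proof -
  define u where "u = t * 2 ^ (k - 1)"
  have "t * 2 ^ k = 2 * u" using assms by (cases k) (auto simp: u_def)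
  moreover have "u \<ge> 0" using assms by (simp add: u_def)
  ultimately show ?thesis unfolding u_def[symmetric] by linarith
qed

section \<open>Averages of a Hoelder path\<close>

locale holder_path =
  fixes g :: "real \<Rightarrow> real" and T \<alpha> H R :: real
  assumes T_le_1: "T \<le> 1" and alpha_pos: "0 < \<alpha>" and H_nonneg: "0 \<le> H"
    and holder: "\<lbrakk>s \<in> {0..T}; t \<in> {0..T}\<rbrakk> \<Longrightarrow> \<bar>g s - g t\<bar> \<le> H * \<bar>s - t\<bar> powr \<alpha>"
    and range: "t \<in> {0..T} \<Longrightarrow> \<bar>g t\<bar> \<le> R"
begin

lemma path_continuous: "continuous_on {0..T} g"
proof (rule continuous_onI)
  fix s e :: real assume s: "s \<in> {0..T}" and e: "0 < e"
  have "((\<lambda>t. H * \<bar>t - s\<bar> powr \<alpha>) \<longlongrightarrow> H * \<bar>s - s\<bar> powr \<alpha>) (at s within {0..T})"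
    using alpha_pos by (intro tendsto_intros tendsto_powr2) auto
  then have "\<forall>\<^sub>F t in at s within {0..T}. H * \<bar>t - s\<bar> powr \<alpha> < e"
    using e by (intro order_tendstoD) auto
  then obtain d where d: "d > 0" "\<And>t. t \<in> {0..T} \<Longrightarrow> t \<noteq> s \<Longrightarrow> dist t s < d \<Longrightarrow> H * \<bar>t - s\<bar> powr \<alpha> < e"
    unfolding eventually_at by auto
  show "\<exists>d>0. \<forall>t\<in>{0..T}. dist t s < d \<longrightarrow> dist (g t) (g s) \<le> e"
  proof (intro exI conjI ballI impI)
    fix t assume t: "t \<in> {0..T}" "dist t s < d"
    show "dist (g t) (g s) \<le> e"
      using holder[OF t(1) s] d(2)[OF t(1) _ t(2)] e by (cases "t = s") (auto simp: dist_real_def)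
  qed (use d in auto)
qed

lemma path_integrable_on: "0 \<le> u \<Longrightarrow> v \<le> T \<Longrightarrow> g integrable_on {u..v}"
  by (intro integrable_continuous_interval continuous_on_subset[OF path_continuous]) auto

lemma avg_range:
  assumes "dyadic k (n + 1) \<le> T"
  shows "avg g k n \<in> {-R..R}"
proof -
  have "norm (integral {dyadic k n..dyadic k (n + 1)} g) \<le> R * (dyadic k (n + 1) - dyadic k n)"
    using assms range by (intro integral_bound continuous_on_subset[OF path_continuous])
      (auto intro: dyadic_mono dest: order_trans[OF dyadic_nonneg])
  also have "\<dots> = R / 2 ^ k" by (simp only: dyadic_add) simp
  finally have "2 ^ k * \<bar>integral {dyadic k n..dyadic k (n + 1)} g\<bar> \<le> R"
    by (simp add: field_simps)
  then have "\<bar>avg g k n\<bar> \<le> R"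
    unfolding avg_def by (simp add: abs_mult)
  then show ?thesis by auto
qed

lemma avg_split:
  assumes "dyadic k (n + 1) \<le> T"
  shows "avg g k n = (avg g (k + 1) (2 * n) + avg g (k + 1) (2 * n + 1)) / 2"
proof -
  have eq: "dyadic k n = dyadic (k + 1) (2 * n)" "dyadic k (n + 1) = dyadic (k + 1) (2 * n + 1 + 1)"
    using dyadic_double[of k n] dyadic_double[of k "n + 1"] by simp_all
  have "integral {dyadic (k + 1) (2 * n)..dyadic (k + 1) (2 * n + 1 + 1)} g
      = integral {dyadic (k + 1) (2 * n)..dyadic (k + 1) (2 * n + 1)} g
      + integral {dyadic (k + 1) (2 * n + 1)..dyadic (k + 1) (2 * n + 1 + 1)} g"
    using assms eq
    by (intro sym[OF Henstock_Kurzweil_Integration.integral_combine] path_integrable_on dyadic_mono) auto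
  then show ?thesis
    unfolding avg_def eq by (simp add: distrib_left)
qed

text \<open>
  The difference of neighbouring averages is the average of \<open>g (t + d) - g t\<close>, where \<open>d\<close> is the mesh.
\<close>

lemma avg_close:
  assumes "dyadic k (n + 2) \<le> T"
  shows "\<bar>avg g k (n + 1) - avg g k n\<bar> \<le> H * 2 powr (- (real k * \<alpha>))"
proof -
  define d where "d = (1 / 2 ^ k :: real)"
  define u where "u = dyadic k n"
  have d: "d > 0" by (simp add: d_def)
  have u: "u \<ge> 0" by (simp add: u_def)
  have s: "dyadic k (n + 1) = u + d" "dyadic k (n + 1 + 1) = u + d + d"
    using dyadic_add[of k n 1] dyadic_add[of k "n+1" 1] by (simp_all add: u_def d_def)
  have le: "u + d + d \<le> T" using assms s by simp
  have c: "continuous_on {u..u + d} (\<lambda>t. g (t + d))" "continuous_on {u..u + d} g"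
    using le u d
    by (auto intro!: continuous_intros continuous_on_compose2[OF path_continuous]
        continuous_on_subset[OF path_continuous])
  have "integral {u + d..u + d + d} g = integral {u..u + d} (g \<circ> (\<lambda>x. x + d))"
    by (rule integral_shift[symmetric])
       (use le u d in \<open>auto intro!: continuous_on_subset[OF path_continuous]\<close>)
  moreover have "norm (integral {u..u + d} (\<lambda>t. g (t + d) - g t)) \<le> H * d powr \<alpha> * (u + d - u)"
  proof (rule integral_bound)
    show "continuous_on {u..u + d} (\<lambda>t. g (t + d) - g t)"
      by (intro continuous_intros c)
    fix t assume t: "t \<in> {u..u + d}"
    then show "norm (g (t + d) - g t) \<le> H * d powr \<alpha>"
      using holder[of "t + d" t] le u d by auto
  qed (use d in simp)
  moreover have "integral {u..u + d} (\<lambda>t. g (t + d) - g t)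
      = integral {u..u + d} (\<lambda>t. g (t + d)) - integral {u..u + d} g"
    by (intro Henstock_Kurzweil_Integration.integral_diff integrable_continuous_interval c)
  ultimately have "\<bar>integral {u + d..u + d + d} g - integral {u..u + d} g\<bar> \<le> H * d powr \<alpha> * d"
    by (simp add: o_def)
  then have "2 ^ k * \<bar>integral {u + d..u + d + d} g - integral {u..u + d} g\<bar> \<le> H * d powr \<alpha>"
    by (simp add: d_def field_simps)
  moreover have "avg g k (n + 1) - avg g k n = 2 ^ k * (integral {u + d..u + d + d} g - integral {u..u + d} g)"
    unfolding avg_def s u_def[symmetric] by (simp add: right_diff_distrib)
  ultimately have "\<bar>avg g k (n + 1) - avg g k n\<bar> \<le> H * d powr \<alpha>"
    by (simp add: abs_mult)
  then show ?thesis by (simp only: d_def half_power_powr)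
qed

lemma avg_children_close:
  assumes "dyadic k (n + 1) \<le> T"
  shows "\<bar>avg g (k + 1) (2 * n) - avg g (k + 1) (2 * n + 1)\<bar> \<le> H * 2 powr (- (real k * \<alpha>))"
proof -
  have "dyadic (k + 1) (2 * n + 2) \<le> T"
    using assms dyadic_double[of k "n + 1"] by simp
  from avg_close[OF this]
  have "\<bar>avg g (k + 1) (2 * n) - avg g (k + 1) (2 * n + 1)\<bar> \<le> H * 2 powr (- (real (k + 1) * \<alpha>))"
    by (simp add: abs_minus_commute)
  also have "\<dots> \<le> H * 2 powr (- (real k * \<alpha>))"
    using H_nonneg alpha_pos by (intro mult_left_mono) auto
  finally show ?thesis .
qed

section \<open>The change from one level to the next\<close>

context
  fixes \<Phi> :: "real \<Rightarrow> real \<Rightarrow> real" and b \<eta> B \<Lambda> \<rho> :: real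
  assumes ctrl: "controlled_primitive \<Phi> b \<eta> R B \<Lambda> \<rho>" and b_le_T: "b \<le> T"
    and B_nonneg: "0 \<le> B" and Lam_nonneg: "0 \<le> \<Lambda>"
begin

lemma primitive_lipschitz:
  "\<lbrakk>t \<in> {0..b}; u \<in> {-R..R}; v \<in> {-R..R}; \<bar>u - v\<bar> \<le> d\<rbrakk> \<Longrightarrow> \<bar>\<Phi> t u - \<Phi> t v\<bar> \<le> B * d"
  using ctrl mult_left_mono[OF _ B_nonneg, of "\<bar>u - v\<bar>" d]
  unfolding controlled_primitive_def by fastforce

lemma primitive_time_holder:
  "\<lbrakk>s \<in> {0..b}; t \<in> {0..b}; \<bar>s - t\<bar> \<le> \<eta>; u \<in> {-R..R}; v \<in> {-R..R}\<rbrakk> \<Longrightarrow>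
     \<bar>(\<Phi> s u - \<Phi> s v) - (\<Phi> t u - \<Phi> t v)\<bar> \<le> \<Lambda> * \<bar>s - t\<bar> powr \<rho> * \<bar>u - v\<bar>"
  using ctrl unfolding controlled_primitive_def by blast

lemma jump_bound:
  assumes "dyadic k (n + 2) \<le> b"
  shows "\<bar>\<Phi> (dyadic k (n + 1)) (avg g k (n + 1)) - \<Phi> (dyadic k (n + 1)) (avg g k n)\<bar>
           \<le> B * (H * 2 powr (- (real k * \<alpha>)))"
proof (rule primitive_lipschitz)
  have *: "dyadic k (n + 1) \<le> dyadic k (n + 2)" by (rule dyadic_mono) simp
  show "dyadic k (n + 1) \<in> {0..b}" using * assms by simp
  show "avg g k (n + 1) \<in> {-R..R}" "avg g k n \<in> {-R..R}"
    using * assms b_le_T by (auto intro!: avg_range simp del: atLeastAtMost_iff)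
  show "\<bar>avg g k (n + 1) - avg g k n\<bar> \<le> H * 2 powr - (real k * \<alpha>)"
    by (rule avg_close) (use assms b_le_T in simp)
qed

text \<open>
  The parent average is the midpoint of its children, so it also stays in the range of the path.
\<close>

lemma avg_near_child:
  assumes "dyadic k (n + 1) \<le> T"
  defines "p \<equiv> avg g (k + 1) (2 * n)" and "q \<equiv> avg g (k + 1) (2 * n + 1)" and "h \<equiv> avg g k n"
  shows "p \<in> {-R..R}" "q \<in> {-R..R}" "h \<in> {-R..R}" "h - p = (q - p) / 2" "q - h = (q - p) / 2"
proof -
  have "dyadic (k + 1) (2 * n + 1 + 1) \<le> T"
    using assms(1) dyadic_double[of k "n + 1"] by simp
  moreover have "dyadic (k + 1) (2 * n + 1) \<le> dyadic (k + 1) (2 * n + 1 + 1)"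
    by (rule dyadic_mono) simp
  ultimately show "p \<in> {-R..R}" "q \<in> {-R..R}" "h \<in> {-R..R}"
    unfolding p_def q_def h_def using assms(1) by (auto intro!: avg_range simp del: atLeastAtMost_iff)
  show "h - p = (q - p) / 2" "q - h = (q - p) / 2"
    using avg_split[OF assms(1)] unfolding p_def q_def h_def by (auto simp: field_simps)
qed

lemma end_defect_bound:
  assumes "dyadic k n \<le> b" and "dyadic k 1 \<le> b"
  shows "\<bar>end_defect \<Phi> g k n\<bar> \<le> B * (H * 2 powr (- (real k * \<alpha>)))"
proof -
  have T: "dyadic k (n - 1 + 1) \<le> T"
    using assms b_le_T by (cases "n = 0") auto
  define p q h where pqh: "p = avg g (k + 1) (2 * (n - 1))" "q = avg g (k + 1) (2 * (n - 1) + 1)"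
    "h = avg g k (n - 1)"
  note near = avg_near_child[OF T, folded pqh]
  have "\<bar>q - p\<bar> \<le> H * 2 powr (- (real k * \<alpha>))"
    using avg_children_close[OF T] by (simp add: pqh abs_minus_commute)
  moreover have "\<bar>h - p\<bar> \<le> \<bar>q - p\<bar>" "\<bar>q - h\<bar> \<le> \<bar>q - p\<bar>"
    unfolding near(4,5) by simp_all
  ultimately have half: "\<bar>p - h\<bar> \<le> H * 2 powr (- (real k * \<alpha>))" "\<bar>q - h\<bar> \<le> H * 2 powr (- (real k * \<alpha>))"
    by linarith+
  have "avg g (k + 1) (2 * n - 1) = p \<or> avg g (k + 1) (2 * n - 1) = q"
    by (cases n) (simp_all add: pqh)
  then show ?thesis
    unfolding end_defect_def pqh(3)[symmetric] using near half assms
    by (elim disjE) (auto intro!: primitive_lipschitz simp del: atLeastAtMost_iff simp: atLeastAtMost_iff[of _ 0])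
qed

text \<open>
  The frozen times at the ends are \<open>2 powr -(k + 1)\<close> away from the midpoint, so time regularity gains the factor
  \<open>2 powr (-(k + 1) * \<rho>)\<close> over the oscillation of the averages. The first bound ignores this gain;
  it serves for the interval that is cut by the left end of \<open>{a..b}\<close>, which \<open>dyadic_variation\<close> may omit.
\<close>

lemma refine_defect_bounds:
  assumes le: "dyadic k (n + 1) \<le> b"
  shows "\<bar>refine_defect \<Phi> g k n\<bar> \<le> 2 * (B * (H * 2 powr (- (real k * \<alpha>))))"
    and "1 / 2 ^ (k + 1) \<le> \<eta> \<Longrightarrow> \<bar>refine_defect \<Phi> g k n\<bar> \<le> \<Lambda> * 2 powr (- (real (k + 1) * \<rho>)) *
           \<bar>avg g (k + 1) (2 * n) - avg g (k + 1) (2 * n + 1)\<bar>"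
proof -
  define p q h where pqh: "p = avg g (k + 1) (2 * n)" "q = avg g (k + 1) (2 * n + 1)" "h = avg g k n"
  define s where "s = dyadic (k + 1) (2 * n + 1)"
  define d :: real where "d = 1 / 2 ^ (k + 1)"
  have T: "dyadic k (n + 1) \<le> T" using le b_le_T by simp
  note range = avg_near_child[OF T, folded pqh]
  have s: "dyadic k n = s - d" "dyadic k (n + 1) = s + d"
    using dyadic_add[of "k + 1" "2 * n" 1] dyadic_add[of "k + 1" "2 * n + 1" 1]
      dyadic_double[of k n] dyadic_double[of k "n + 1"]
    by (simp_all add: s_def d_def)
  have d: "0 < d" by (simp add: d_def)
  have times: "s - d \<in> {0..b}" "s \<in> {0..b}" "s + d \<in> {0..b}"
    using s le d dyadic_nonneg[of k n] by auto
  have qp: "\<bar>q - p\<bar> \<le> H * 2 powr (- (real k * \<alpha>))"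
    using avg_children_close[OF T] by (simp add: pqh abs_minus_commute)
  have eq: "refine_defect \<Phi> g k n = (\<Phi> s q - \<Phi> s p) - (\<Phi> (s - d) h - \<Phi> (s - d) p) - (\<Phi> (s + d) q - \<Phi> (s + d) h)"
    unfolding refine_defect_def Let_def s pqh s_def by (rule refl)
  have "\<bar>h - p\<bar> \<le> \<bar>q - p\<bar> / 2" "\<bar>q - h\<bar> \<le> \<bar>q - p\<bar> / 2"
    unfolding range(4,5) by simp_all
  then have "\<bar>\<Phi> (s - d) h - \<Phi> (s - d) p\<bar> \<le> B * (\<bar>q - p\<bar> / 2)"
    "\<bar>\<Phi> (s + d) q - \<Phi> (s + d) h\<bar> \<le> B * (\<bar>q - p\<bar> / 2)"
    using times range by (blast intro: primitive_lipschitz)+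
  moreover have "\<bar>\<Phi> s q - \<Phi> s p\<bar> \<le> B * \<bar>q - p\<bar>"
    using times range by (blast intro: primitive_lipschitz)
  ultimately have "\<bar>refine_defect \<Phi> g k n\<bar> \<le> 2 * (B * \<bar>q - p\<bar>)"
    unfolding eq by linarith
  also have "\<dots> \<le> 2 * (B * (H * 2 powr (- (real k * \<alpha>))))"
    using qp B_nonneg by (intro mult_left_mono) auto
  finally show "\<bar>refine_defect \<Phi> g k n\<bar> \<le> 2 * (B * (H * 2 powr (- (real k * \<alpha>))))" .
  assume eta: "1 / 2 ^ (k + 1) \<le> \<eta>"
  have "\<bar>(\<Phi> s h - \<Phi> s p) - (\<Phi> (s - d) h - \<Phi> (s - d) p)\<bar> \<le> \<Lambda> * \<bar>s - (s - d)\<bar> powr \<rho> * \<bar>h - p\<bar>"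
    using range times eta d by (intro primitive_time_holder) (auto simp: d_def)
  moreover have "\<bar>(\<Phi> s q - \<Phi> s h) - (\<Phi> (s + d) q - \<Phi> (s + d) h)\<bar> \<le> \<Lambda> * \<bar>s - (s + d)\<bar> powr \<rho> * \<bar>q - h\<bar>"
    using range times eta d by (intro primitive_time_holder) (auto simp: d_def)
  ultimately have "\<bar>refine_defect \<Phi> g k n\<bar> \<le> \<Lambda> * d powr \<rho> * \<bar>h - p\<bar> + \<Lambda> * d powr \<rho> * \<bar>q - h\<bar>"
    unfolding eq using d by simp
  also have "\<dots> = \<Lambda> * d powr \<rho> * \<bar>p - q\<bar>"
  proof -
    have "\<bar>h - p\<bar> + \<bar>q - h\<bar> = \<bar>p - q\<bar>"
      unfolding range(4,5) by (simp add: abs_minus_commute)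
    then show ?thesis by (simp flip: distrib_left)
  qed
  finally show "\<bar>refine_defect \<Phi> g k n\<bar> \<le> \<Lambda> * 2 powr (- (real (k + 1) * \<rho>)) *
           \<bar>avg g (k + 1) (2 * n) - avg g (k + 1) (2 * n + 1)\<bar>"
    by (simp only: d_def half_power_powr pqh)
qed

text \<open>
  By parity, stopping at the last complete dyadic interval instead of the last complete pair of
  siblings adds at most one jump.
\<close>

lemma running_sum_truncation:
  assumes "0 \<le> t" "t \<le> b" "1 \<le> k"
  shows "\<bar>jump_sum \<Phi> g k (nat \<lfloor>t * 2 ^ k\<rfloor>) - running_sum \<Phi> g t k\<bar> \<le> B * (H * 2 powr (- (real k * \<alpha>)))"
proof -
  define N where "N = nat \<lfloor>t * 2 ^ (k - 1)\<rfloor>"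
  have path: "running_sum \<Phi> g t k = jump_sum \<Phi> g k (2 * N)"
    by (simp add: running_sum_def N_def)
  consider "nat \<lfloor>t * 2 ^ k\<rfloor> = 2 * N" | "nat \<lfloor>t * 2 ^ k\<rfloor> = 2 * N + 1" "N = 0"
    | m where "nat \<lfloor>t * 2 ^ k\<rfloor> = m + 2" "2 * N = Suc m"
    using dyadic_floor_parity[OF assms(1,3)] unfolding N_def[symmetric]
    by (metis Suc_1 Suc_eq_plus1 add_2_eq_Suc' mult_eq_0_iff not0_implies_Suc)
  then show ?thesis
  proof cases
    case 3
    then have "dyadic k (m + 2) \<le> b" using dyadic_floor_le[OF assms(1), of k] assms(2) by simp
    from jump_bound[OF this] show ?thesis
      unfolding path 3 using jump_sum_Suc[of \<Phi> g k "Suc m"] by simp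
  qed (use B_nonneg H_nonneg in \<open>auto simp: path jump_sum_def\<close>)
qed

text \<open>
  All intervals inside \<open>{a..b}\<close> contribute through the dyadic variation. The six boundary terms are
  one truncation and one end defect at each of \<open>a\<close> and \<open>b\<close>, and the interval that contains \<open>a\<close>,
  which counts twice.
\<close>

lemma level_increment_step:
  assumes "0 \<le> a" "a \<le> b" "1 \<le> k" "1 / 2 ^ (k + 1) \<le> \<eta>"
  shows "\<bar>(running_sum \<Phi> g b (k + 1) - running_sum \<Phi> g a (k + 1))
          - (running_sum \<Phi> g b k - running_sum \<Phi> g a k)\<bar>
       \<le> 6 * (B * (H * 2 powr (- (real k * \<alpha>))))
         + \<Lambda> * 2 powr (- (real (k + 1) * \<rho>)) * dyadic_variation g a b k"
proof -
  define M N where MN: "M = nat \<lfloor>a * 2 ^ k\<rfloor>" "N = nat \<lfloor>b * 2 ^ k\<rfloor>"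
  define X where "X = B * (H * 2 powr (- (real k * \<alpha>)))"
  define w where "w n = \<bar>avg g (k + 1) (2 * n) - avg g (k + 1) (2 * n + 1)\<bar>" for n
  define L where "L = \<Lambda> * 2 powr (- (real (k + 1) * \<rho>))"
  have nonneg: "0 \<le> X" "0 \<le> L" "0 \<le> dyadic_variation g a b k"
    using B_nonneg H_nonneg Lam_nonneg by (auto simp: X_def L_def dyadic_variation_def intro: sum_nonneg)
  have "M \<le> N" unfolding MN using assms by (intro nat_mono floor_mono) auto
  have Nb: "dyadic k N \<le> b" and Ma: "dyadic k M \<le> a"
    using assms by (simp_all add: MN dyadic_floor_le)
  have Ma1: "a < dyadic k (M + 1)"
  proof -
    have "a * 2 ^ k < real M + 1" unfolding MN using assms(1) by (simp add: floor_less_cancel)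
    then show ?thesis by (simp add: dyadic_def field_simps)
  qed
  \<comment> \<open>The intervals strictly between those of \<open>a\<close> and \<open>b\<close>; \<open>mu\<close> numbers them from \<open>1\<close>.\<close>
  let ?Q = "\<lambda>n. jump_sum \<Phi> g (k + 1) (2 * n) - jump_sum \<Phi> g k n"
  have inner: "(\<Sum>n\<in>{M<..<N}. \<bar>refine_defect \<Phi> g k n\<bar>) \<le> L * dyadic_variation g a b k"
  proof -
    have "(\<Sum>n\<in>{M<..<N}. \<bar>refine_defect \<Phi> g k n\<bar>) \<le> (\<Sum>n\<in>{M<..<N}. L * w n)"
    proof (rule sum_mono)
      fix n assume n: "n \<in> {M<..<N}"
      then have "dyadic k (n + 1) \<le> dyadic k N" by (intro dyadic_mono) auto
      then have "dyadic k (n + 1) \<le> b" using Nb by simp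
      from refine_defect_bounds(2)[OF this assms(4)]
      show "\<bar>refine_defect \<Phi> g k n\<bar> \<le> L * w n" by (simp add: L_def w_def)
    qed
    also have "\<dots> = L * (\<Sum>n\<in>Suc ` {M<..<N}. w (n - 1))"
      by (simp add: sum_distrib_left sum.reindex)
    also have "\<dots> \<le> L * dyadic_variation g a b k"
      unfolding dyadic_variation_def w_def[symmetric]
    proof (intro mult_left_mono sum_mono2 nonneg)
      have "{n. 1 \<le> n \<and> {dyadic k (n - 1)..dyadic k n} \<subseteq> {a..b}} \<subseteq> {..nat \<lfloor>b * 2 ^ k\<rfloor>}"
      proof
        fix n assume "n \<in> {n. 1 \<le> n \<and> {dyadic k (n - 1)..dyadic k n} \<subseteq> {a..b}}"
        then have "dyadic k n \<le> b" using dyadic_mono[of "n - 1" n k] by auto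
        then show "n \<in> {..nat \<lfloor>b * 2 ^ k\<rfloor>}" unfolding dyadic_le_iff by (simp add: le_nat_floor)
      qed
      then show "finite {n. 1 \<le> n \<and> {dyadic k (n - 1)..dyadic k n} \<subseteq> {a..b}}"
        by (rule finite_subset) simp
      show "Suc ` {M<..<N} \<subseteq> {n. 1 \<le> n \<and> {dyadic k (n - 1)..dyadic k n} \<subseteq> {a..b}}"
      proof
        fix i assume "i \<in> Suc ` {M<..<N}"
        then obtain n where n: "M < n" "n < N" "i = Suc n" by auto
        have "dyadic k (M + 1) \<le> dyadic k n" "dyadic k (Suc n) \<le> dyadic k N"
          using n by (auto intro!: dyadic_mono)
        then show "i \<in> {n. 1 \<le> n \<and> {dyadic k (n - 1)..dyadic k n} \<subseteq> {a..b}}"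
          using Ma1 Nb n(3) by auto
      qed
    qed (simp add: w_def)
    finally show ?thesis .
  qed
  have "\<bar>?Q N - ?Q M\<bar> \<le> 4 * X + L * dyadic_variation g a b k"
  proof (cases "M = N")
    case True
    then show ?thesis using nonneg by simp
  next
    case False
    then have MN': "M < N" using \<open>M \<le> N\<close> by simp
    have "dyadic k (M + 1) \<le> dyadic k N" "dyadic k 1 \<le> dyadic k N"
      using MN' by (auto intro!: dyadic_mono)
    then have le: "dyadic k (M + 1) \<le> b" "dyadic k 1 \<le> b" "dyadic k M \<le> b"
      using Nb Ma assms(2) by auto
    have "{M..<N} = insert M {M<..<N}" using MN' by auto
    then have "(\<Sum>n\<in>{M..<N}. refine_defect \<Phi> g k n)
        = refine_defect \<Phi> g k M + (\<Sum>n\<in>{M<..<N}. refine_defect \<Phi> g k n)" by simp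
    then show ?thesis
      using jump_sum_refine[OF \<open>M \<le> N\<close>, of \<Phi> g k] inner refine_defect_bounds(1)[OF le(1)]
        end_defect_bound[OF Nb le(2)] end_defect_bound[OF le(3,2)]
        sum_abs[of "refine_defect \<Phi> g k" "{M<..<N}"]
      unfolding X_def[symmetric] by linarith
  qed
  moreover have "running_sum \<Phi> g b (k + 1) = jump_sum \<Phi> g (k + 1) (2 * N)"
    "running_sum \<Phi> g a (k + 1) = jump_sum \<Phi> g (k + 1) (2 * M)"
    by (simp_all add: running_sum_def MN)
  moreover have "\<bar>jump_sum \<Phi> g k N - running_sum \<Phi> g b k\<bar> \<le> X"
    "\<bar>jump_sum \<Phi> g k M - running_sum \<Phi> g a k\<bar> \<le> X"
    unfolding X_def MN using assms by (auto intro!: running_sum_truncation)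
  ultimately show ?thesis
    unfolding X_def[symmetric] L_def[symmetric] by linarith
qed

text \<open>
  Counting jumps: useful at the level whose mesh is comparable with \<open>b - a\<close>, where there are only
  boundedly many of them.
\<close>

lemma level_increment_crude:
  assumes "0 \<le> a" "a \<le> b" "1 \<le> k"
  shows "\<bar>running_sum \<Phi> g b k - running_sum \<Phi> g a k\<bar>
       \<le> (2 * ((b - a) * 2 ^ (k - 1) + 1)) * (B * (H * 2 powr (- (real k * \<alpha>))))"
proof -
  define M N where MN: "M = nat \<lfloor>a * 2 ^ (k - 1)\<rfloor>" "N = nat \<lfloor>b * 2 ^ (k - 1)\<rfloor>"
  define X where "X = B * (H * 2 powr (- (real k * \<alpha>)))"
  have X: "0 \<le> X" using B_nonneg H_nonneg by (simp add: X_def)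
  have le: "M \<le> N" unfolding MN using assms by (intro nat_mono floor_mono) auto
  have "dyadic (k - 1) N \<le> b" unfolding MN using assms by (intro dyadic_floor_le) auto
  then have Nb: "dyadic k (2 * N) \<le> b" using dyadic_double[of "k - 1" N] assms(3) by simp
  have jump: "\<bar>jump_sum \<Phi> g k (Suc n) - jump_sum \<Phi> g k n\<bar> \<le> X" if n: "n < 2 * N" for n
  proof (cases n)
    case (Suc m)
    have "dyadic k (m + 2) \<le> dyadic k (2 * N)" using n Suc by (intro dyadic_mono) auto
    from jump_bound[OF order_trans[OF this Nb]] show ?thesis using Suc by (simp add: jump_sum_Suc X_def)
  qed (use X in \<open>simp add: jump_sum_Suc\<close>)
  have "\<bar>jump_sum \<Phi> g k n - jump_sum \<Phi> g k (2 * M)\<bar> \<le> real (n - 2 * M) * X"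
    if "2 * M \<le> n" "n \<le> 2 * N" for n
    using that
  proof (induction n rule: dec_induct)
    case (step n)
    have "real (Suc n - 2 * M) * X = real (n - 2 * M) * X + X"
      using step by (simp add: Suc_diff_le distrib_right)
    then show ?case using step jump[of n] by simp
  qed simp
  from this[of "2 * N"] le
  have "\<bar>running_sum \<Phi> g b k - running_sum \<Phi> g a k\<bar> \<le> real (2 * N - 2 * M) * X"
    by (simp add: running_sum_def MN)
  also have "real (2 * N - 2 * M) \<le> 2 * ((b - a) * 2 ^ (k - 1) + 1)"
  proof -
    have "real N \<le> b * 2 ^ (k - 1)" "a * 2 ^ (k - 1) < real M + 1"
      unfolding MN using assms by (auto simp: floor_less_cancel)
    then show ?thesis using le by (simp add: of_nat_diff algebra_simps)
  qed
  finally show ?thesis unfolding X_def using X by (simp add: X_def mult_right_mono)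
qed

end

end

section \<open>Convergence of the level sums\<close>

lemma geometric_increments_converge:
  fixes s :: "nat \<Rightarrow> real"
  assumes q: "0 < q" "q < 1" and C: "0 \<le> C"
    and step: "\<And>k. K \<le> k \<Longrightarrow> \<bar>s (k + 1) - s k\<bar> \<le> C * q ^ k"
  shows "convergent s" and "K \<le> k \<Longrightarrow> \<bar>s k - lim s\<bar> \<le> C * q ^ k / (1 - q)"
proof -
  have "summable (\<lambda>k. C * q ^ k)"
    using q by (intro summable_mult summable_geometric) auto
  then have "summable (\<lambda>k. s (k + 1) - s k)"
    by (rule summable_comparison_test'[where N = K]) (use step in auto)
  then have "convergent (\<lambda>n. (\<Sum>k<n. s (Suc k) - s k) + s 0)"
    by (intro convergent_add) (auto simp: summable_iff_convergent convergent_const)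
  then show conv: "convergent s"
    by (simp add: sum_lessThan_telescope)
  assume k: "K \<le> k"
  have "\<bar>s (k + n) - s k\<bar> \<le> C * q ^ k * (1 - q ^ n) / (1 - q)" for n
  proof (induction n)
    case (Suc n)
    have "C * q ^ k * (1 - q ^ Suc n) / (1 - q) = C * q ^ k * (1 - q ^ n) / (1 - q) + C * q ^ (k + n)"
      using q by (simp add: field_simps power_add)
    then show ?case using Suc step[of "k + n"] k by simp
  qed simp
  also have "C * q ^ k * (1 - q ^ n) / (1 - q) \<le> C * q ^ k / (1 - q)" for n
    using q C by (intro divide_right_mono) (auto intro!: mult_left_le)
  finally have bound: "\<bar>s k - s (k + n)\<bar> \<le> C * q ^ k / (1 - q)" for n
    by (simp add: abs_minus_commute)
  have "(\<lambda>n. s (n + k)) \<longlonglongrightarrow> lim s"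
    using conv by (intro LIMSEQ_ignore_initial_segment) (simp add: convergent_LIMSEQ_iff)
  then have "(\<lambda>n. \<bar>s k - s (n + k)\<bar>) \<longlonglongrightarrow> \<bar>s k - lim s\<bar>"
    by (intro tendsto_intros)
  then show "\<bar>s k - lim s\<bar> \<le> C * q ^ k / (1 - q)"
    by (rule LIMSEQ_le_const2) (use bound in \<open>auto simp: add.commute\<close>)
qed

text \<open>
  The index \<open>k\<^sub>0 + 1\<close> at which the series \<open>mu\<close> of an interval of length \<open>d\<close> starts.
\<close>

definition first_level :: "real \<Rightarrow> nat" where
  "first_level d = nat \<lfloor>log 2 (2 / d)\<rfloor> + 1"

text \<open>
  The mesh of this level is comparable with \<open>d\<close>: at most \<open>d\<close>, and at least \<open>d / 4\<close>.
\<close>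

lemma first_level_bounds:
  assumes "0 < d" "d \<le> 1"
  shows "d * 2 ^ (first_level d - 1) \<le> 2" and "1 / 2 ^ first_level d \<le> d"
proof -
  define l where "l = log 2 (2 / d)"
  have "1 \<le> l" using assms by (simp add: l_def le_log_iff le_divide_eq)
  then have l: "real (nat \<lfloor>l\<rfloor>) \<le> l" "l < real (nat \<lfloor>l\<rfloor>) + 1" by auto
  have p: "2 powr l = 2 / d" using assms by (simp add: l_def)
  have "2 ^ nat \<lfloor>l\<rfloor> \<le> 2 / d"
    using l(1) by (simp add: p[symmetric] powr_mono flip: powr_realpow)
  then show "d * 2 ^ (first_level d - 1) \<le> 2"
    using assms by (simp add: first_level_def flip: l_def) (simp add: field_simps)
  have "2 / d \<le> 2 powr (real (nat \<lfloor>l\<rfloor>) + 1)"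
    unfolding p[symmetric] using l(2) by (intro powr_mono) auto
  also have "\<dots> = 2 ^ first_level d"
    unfolding first_level_def l_def by (simp add: powr_add powr_realpow)
  finally show "1 / 2 ^ first_level d \<le> d"
    using assms by (simp add: field_simps)
qed

text \<open>
  A Hoelder path whose series \<open>mu\<close> obeys the bound that a finite \<open>G_norm\<close> gives, in the form of
  partial sums of real numbers.
\<close>

locale dyadic_rough_path = holder_path +
  fixes \<beta>\<^sub>0 \<gamma> G :: real
  assumes G_nonneg: "0 \<le> G" and exponent_nonneg: "0 \<le> \<beta>\<^sub>0 + \<gamma>"
    and variation: "\<lbrakk>0 \<le> a; a < b; b \<le> T\<rbrakk> \<Longrightarrow>
      (\<Sum>k\<in>{first_level (b - a)..<first_level (b - a) + n}.
         2 powr (- (real (k + 1) * \<beta>\<^sub>0)) * dyadic_variation g a b k) \<le> G * (b - a) powr (\<beta>\<^sub>0 + \<gamma>)"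
begin

lemma dyadic_variation_nonneg: "0 \<le> dyadic_variation g a b k"
  unfolding dyadic_variation_def by (intro sum_nonneg) auto

lemma weighted_variation_bound:
  assumes "0 < b" "b \<le> T" "first_level b \<le> k"
  shows "2 powr (- (real (k + 1) * \<beta>\<^sub>0)) * dyadic_variation g 0 b k \<le> G"
proof -
  have "2 powr (- (real (k + 1) * \<beta>\<^sub>0)) * dyadic_variation g 0 b k
      \<le> (\<Sum>k\<in>{first_level b..<first_level b + (k + 1)}.
         2 powr (- (real (k + 1) * \<beta>\<^sub>0)) * dyadic_variation g 0 b k)"
    using assms by (intro member_le_sum) (auto simp: dyadic_variation_nonneg)
  also have "\<dots> \<le> G * b powr (\<beta>\<^sub>0 + \<gamma>)"
    using variation[of 0 b "k + 1"] assms by simp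
  also have "\<dots> \<le> G * 1"
    using assms T_le_1 G_nonneg exponent_nonneg by (intro mult_left_mono powr_le1) auto
  finally show ?thesis by simp
qed

context
  fixes \<Phi> :: "real \<Rightarrow> real \<Rightarrow> real" and b \<eta> B \<Lambda> \<rho> :: real
  assumes ctrl: "controlled_primitive \<Phi> b \<eta> R B \<Lambda> \<rho>" and b_le_T: "b \<le> T"
    and B_nonneg: "0 \<le> B" and Lam_nonneg: "0 \<le> \<Lambda>" and rho: "\<beta>\<^sub>0 < \<rho>"
begin

text \<open>
  The one-step estimate decays geometrically: the boundary terms like \<open>2 powr (-k * \<alpha>)\<close>, and the
  inner terms like \<open>2 powr (-k * (\<rho> - \<beta>\<^sub>0))\<close>, because the variation weighted with the exponent \<open>\<beta>\<^sub>0\<close> is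
  bounded. The rate does not depend on \<open>\<Phi>\<close>.
\<close>

lemma running_sum_converges:
  assumes "0 < b" "b \<le> \<eta>"
  defines "q \<equiv> max (2 powr - \<alpha>) (2 powr - (\<rho> - \<beta>\<^sub>0))"
  shows "convergent (running_sum \<Phi> g b)"
    and "first_level b \<le> k \<Longrightarrow>
      \<bar>running_sum \<Phi> g b k - lim (running_sum \<Phi> g b)\<bar> \<le> (6 * B * H + \<Lambda> * G) * q ^ k / (1 - q)"
proof -
  have q: "0 < q" "q < 1"
    using alpha_pos rho unfolding q_def less_max_iff_disj max_less_iff_conj by (auto simp: powr_less_one)
  have C: "0 \<le> 6 * B * H + \<Lambda> * G" using B_nonneg H_nonneg Lam_nonneg G_nonneg by simp
  have b1: "b \<le> 1" using b_le_T T_le_1 by simp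
  have step: "\<bar>running_sum \<Phi> g b (k + 1) - running_sum \<Phi> g b k\<bar> \<le> (6 * B * H + \<Lambda> * G) * q ^ k"
    if k: "first_level b \<le> k" for k
  proof -
    have "(1::real) / 2 ^ (k + 1) \<le> 1 / 2 ^ first_level b" using k by (intro divide_left_mono power_increasing) auto
    also have "\<dots> \<le> \<eta>" using first_level_bounds(2)[OF assms(1) b1] assms(2) by simp
    finally have eta: "1 / 2 ^ (k + 1) \<le> \<eta>" .
    have "1 \<le> k" using k by (simp add: first_level_def)
    have zero: "running_sum \<Phi> g 0 l = 0" for l by (simp add: running_sum_def jump_sum_def)
    have geo: "2 powr (- (real k * r)) = (2 powr - r) ^ k" for r and k :: nat
      by (simp add: powr_power mult.commute)
    have "2 powr (- (real (k + 1) * \<rho>)) * dyadic_variation g 0 b k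
        = 2 powr (- (real (k + 1) * (\<rho> - \<beta>\<^sub>0))) * (2 powr (- (real (k + 1) * \<beta>\<^sub>0)) * dyadic_variation g 0 b k)"
      by (simp add: algebra_simps flip: powr_add)
    also have "\<dots> \<le> 2 powr (- (real (k + 1) * (\<rho> - \<beta>\<^sub>0))) * G"
      using weighted_variation_bound[OF assms(1) b_le_T k] by (intro mult_left_mono) auto
    also have "\<dots> = G * (2 powr - (\<rho> - \<beta>\<^sub>0)) ^ (k + 1)"
      unfolding geo by simp
    also have "\<dots> \<le> G * q ^ (k + 1)"
      using G_nonneg by (intro mult_left_mono power_mono) (auto simp: q_def)
    also have "\<dots> \<le> G * q ^ k"
      using G_nonneg q by (intro mult_left_mono power_decreasing) auto
    finally have 1: "\<Lambda> * (2 powr (- (real (k + 1) * \<rho>)) * dyadic_variation g 0 b k) \<le> \<Lambda> * (G * q ^ k)"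
      using Lam_nonneg by (rule mult_left_mono)
    have "2 powr (- (real k * \<alpha>)) \<le> q ^ k"
      unfolding geo by (intro power_mono) (auto simp: q_def)
    then have 2: "6 * (B * (H * 2 powr (- (real k * \<alpha>)))) \<le> 6 * (B * (H * q ^ k))"
      using B_nonneg H_nonneg by (intro mult_left_mono) auto
    show ?thesis
      using level_increment_step[OF ctrl b_le_T B_nonneg Lam_nonneg order_refl less_imp_le[OF assms(1)] \<open>1 \<le> k\<close> eta] 1 2
      by (simp add: zero algebra_simps)
  qed
  show "convergent (running_sum \<Phi> g b)"
    by (rule geometric_increments_converge(1)[OF q C step])
  show "first_level b \<le> k \<Longrightarrow>
      \<bar>running_sum \<Phi> g b k - lim (running_sum \<Phi> g b)\<bar> \<le> (6 * B * H + \<Lambda> * G) * q ^ k / (1 - q)"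
    by (rule geometric_increments_converge(2)[OF q C step])
qed

text \<open>
  Start at the level where the mesh is comparable with \<open>b - a\<close> and add up the later steps. At the
  start at most six jumps of size \<open>(b - a) powr \<alpha>\<close> occur, and the boundary terms of the steps form a
  geometric series with the same first term. In the inner terms the factor \<open>2 powr (-k * (\<rho> - \<beta>\<^sub>0))\<close>
  is at most \<open>(b - a) powr (\<rho> - \<beta>\<^sub>0)\<close>, and the rest is a partial sum of \<open>mu\<close>, of order
  \<open>(b - a) powr (\<beta>\<^sub>0 + \<gamma>)\<close>.
\<close>

lemma level_increment_bound:
  assumes "0 \<le> a" "a < b" "b - a \<le> \<eta>"
  shows "\<bar>running_sum \<Phi> g b (first_level (b - a) + n) - running_sum \<Phi> g a (first_level (b - a) + n)\<bar>
    \<le> (6 + 6 / (1 - 2 powr - \<alpha>)) * (B * H) * (b - a) powr \<alpha> + \<Lambda> * G * (b - a) powr (\<rho> + \<gamma>)"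
proof -
  define K where "K = first_level (b - a)"
  define X where "X = B * H * (b - a) powr \<alpha>"
  define p where "p = 2 powr - \<alpha>"
  define W where "W k = 2 powr (- (real (k + 1) * \<beta>\<^sub>0)) * dyadic_variation g a b k" for k
  define D where "D k = running_sum \<Phi> g b k - running_sum \<Phi> g a k" for k
  have d: "0 < b - a" "b - a \<le> 1" using assms b_le_T T_le_1 by auto
  note K = first_level_bounds[OF d, folded K_def]
  have K1: "1 \<le> K" by (simp add: K_def first_level_def)
  have p: "0 < p" "p < 1" using alpha_pos by (auto simp: p_def powr_less_one)
  have X: "0 \<le> X" using B_nonneg H_nonneg by (simp add: X_def)
  \<comment> \<open>The boundary terms at level \<open>K + i\<close>, compared with the interval length.\<close>
  have base: "B * (H * 2 powr (- (real (K + i) * \<alpha>))) \<le> X * p ^ i" for i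
  proof -
    have pow: "p ^ i = 2 powr (- (real i * \<alpha>))"
      by (simp add: p_def powr_power mult.commute)
    have "2 powr (- (real (K + i) * \<alpha>)) = (1 / 2 ^ K) powr \<alpha> * p ^ i"
      unfolding half_power_powr pow by (simp add: algebra_simps flip: powr_add)
    also have "\<dots> \<le> (b - a) powr \<alpha> * p ^ i"
      using K(2) alpha_pos p by (intro mult_right_mono powr_mono2) auto
    finally have "B * H * 2 powr (- (real (K + i) * \<alpha>)) \<le> B * H * ((b - a) powr \<alpha> * p ^ i)"
      using B_nonneg H_nonneg by (intro mult_left_mono) auto
    then show ?thesis by (simp add: X_def mult.assoc)
  qed
  have "\<bar>D K\<bar> \<le> (2 * ((b - a) * 2 ^ (K - 1) + 1)) * (B * (H * 2 powr (- (real K * \<alpha>))))"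
    unfolding D_def using assms K1
    by (intro level_increment_crude[OF ctrl b_le_T B_nonneg Lam_nonneg]) auto
  also have "\<dots> \<le> 6 * X"
    using K(1) base[of 0] B_nonneg H_nonneg by (intro mult_mono) auto
  finally have DK: "\<bar>D K\<bar> \<le> 6 * X" .
  have step: "\<bar>D (K + i + 1) - D (K + i)\<bar> \<le> 6 * (X * p ^ i) + \<Lambda> * (b - a) powr (\<rho> - \<beta>\<^sub>0) * W (K + i)" for i
  proof -
    have "(1::real) / 2 ^ (K + i + 1) \<le> 1 / 2 ^ K" by (intro divide_left_mono power_increasing) auto
    then have small: "1 / 2 ^ (K + i + 1) \<le> b - a" using K(2) by linarith
    then have "\<bar>D (K + i + 1) - D (K + i)\<bar> \<le> 6 * (B * (H * 2 powr (- (real (K + i) * \<alpha>))))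
         + \<Lambda> * 2 powr (- (real (K + i + 1) * \<rho>)) * dyadic_variation g a b (K + i)"
      unfolding D_def using assms K1
      by (intro level_increment_step[OF ctrl b_le_T B_nonneg Lam_nonneg]) auto
    moreover have "\<Lambda> * 2 powr (- (real (K + i + 1) * \<rho>)) * dyadic_variation g a b (K + i)
        \<le> \<Lambda> * (b - a) powr (\<rho> - \<beta>\<^sub>0) * W (K + i)"
    proof -
      have "2 powr (- (real (K + i + 1) * \<rho>)) = (1 / 2 ^ (K + i + 1)) powr (\<rho> - \<beta>\<^sub>0) * 2 powr (- (real (K + i + 1) * \<beta>\<^sub>0))"
        unfolding half_power_powr by (simp add: algebra_simps flip: powr_add)
      also have "\<dots> \<le> (b - a) powr (\<rho> - \<beta>\<^sub>0) * 2 powr (- (real (K + i + 1) * \<beta>\<^sub>0))"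
        using small rho by (intro mult_right_mono powr_mono2) auto
      finally have "2 powr (- (real (K + i + 1) * \<rho>)) * dyadic_variation g a b (K + i)
         \<le> (b - a) powr (\<rho> - \<beta>\<^sub>0) * 2 powr (- (real (K + i + 1) * \<beta>\<^sub>0)) * dyadic_variation g a b (K + i)"
        by (intro mult_right_mono dyadic_variation_nonneg)
      from mult_left_mono[OF this Lam_nonneg] show ?thesis by (simp add: W_def mult.assoc)
    qed
    ultimately show ?thesis using base[of i] by linarith
  qed
  have total: "\<bar>D (K + n)\<bar> \<le> 6 * X + 6 * X * ((1 - p ^ n) / (1 - p))
      + \<Lambda> * (b - a) powr (\<rho> - \<beta>\<^sub>0) * (\<Sum>k\<in>{K..<K + n}. W k)" for n
  proof (induction n)
    case (Suc n)
    have "6 * X * ((1 - p ^ Suc n) / (1 - p)) = 6 * X * ((1 - p ^ n) / (1 - p)) + 6 * (X * p ^ n)"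
      using p by (simp add: field_simps)
    then show ?case using Suc step[of n] by (simp add: distrib_left)
  qed (use DK in simp)
  have "6 * X * ((1 - p ^ n) / (1 - p)) \<le> 6 * X * (1 / (1 - p))"
    using X p by (intro mult_left_mono divide_right_mono) auto
  moreover have "\<Lambda> * (b - a) powr (\<rho> - \<beta>\<^sub>0) * (\<Sum>k\<in>{K..<K + n}. W k)
      \<le> \<Lambda> * (b - a) powr (\<rho> - \<beta>\<^sub>0) * (G * (b - a) powr (\<beta>\<^sub>0 + \<gamma>))"
    using variation[of a b n] assms b_le_T Lam_nonneg by (intro mult_left_mono) (auto simp: K_def W_def)
  moreover have "\<Lambda> * (b - a) powr (\<rho> - \<beta>\<^sub>0) * (G * (b - a) powr (\<beta>\<^sub>0 + \<gamma>)) = \<Lambda> * G * (b - a) powr (\<rho> + \<gamma>)"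
    by (simp add: powr_add[symmetric] mult.assoc mult.left_commute)
  moreover have "6 * X + 6 * X * (1 / (1 - p)) = (6 + 6 / (1 - p)) * X"
    by (simp add: distrib_right)
  ultimately have "\<bar>D (K + n)\<bar> \<le> (6 + 6 / (1 - p)) * X + \<Lambda> * G * (b - a) powr (\<rho> + \<gamma>)"
    using total[of n] by linarith
  then show ?thesis
    unfolding D_def K_def X_def p_def by (simp add: mult.assoc)
qed

end

end

section \<open>Existence and increments of the path integral\<close>

definition primitive :: "(real \<Rightarrow> real \<Rightarrow> real) \<Rightarrow> real \<Rightarrow> real \<Rightarrow> real" where
  "primitive f t u = (LBINT \<xi>=(0::real)..u. f t \<xi>)"

lemma interval_integral_primitive:
  assumes "continuous_on UNIV (f t)"
  shows "(LBINT \<xi>=(u::real)..(v::real). f t \<xi>) = primitive f t v - primitive f t u"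
proof -
  have "interval_lebesgue_integrable lborel (ereal (min 0 (min u v))) (ereal (max 0 (max u v))) (f t)"
    by (rule interval_integrable_continuous_on) (auto intro: continuous_on_subset[OF assms])
  then have "(LBINT \<xi>=(0::real)..u. f t \<xi>) + (LBINT \<xi>=u..v. f t \<xi>) = (LBINT \<xi>=(0::real)..v. f t \<xi>)"
    by (intro interval_integral_sum) (simp flip: ereal_min ereal_max)
  then show ?thesis by (simp add: primitive_def)
qed

text \<open>
  Two integrands are allowed here because the estimate is used both for one integrand at two times
  and for two integrands at one time.
\<close>

lemma primitive_difference_bound:
  fixes f f' :: "real \<Rightarrow> real \<Rightarrow> real"
  assumes cont: "continuous_on UNIV (f s)" "continuous_on UNIV (f' t)"
    and bound: "\<And>\<xi>. \<xi> \<in> {-R..R} \<Longrightarrow> \<bar>f s \<xi> - f' t \<xi>\<bar> \<le> B"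
    and uv: "u \<in> {-R..R}" "v \<in> {-R..R}"
  shows "\<bar>(primitive f s u - primitive f s v) - (primitive f' t u - primitive f' t v)\<bar> \<le> B * \<bar>u - v\<bar>"
proof -
  have *: "\<bar>(primitive f s u - primitive f s v) - (primitive f' t u - primitive f' t v)\<bar> \<le> B * (u - v)"
    if "v \<le> u" "u \<in> {-R..R}" "v \<in> {-R..R}" for u v
  proof -
    let ?h = "\<lambda>\<xi>. f s \<xi> - f' t \<xi>"
    have c: "continuous_on {v..u} ?h"
      by (intro continuous_intros continuous_on_subset[OF cont(1)] continuous_on_subset[OF cont(2)]) auto
    have i: "interval_lebesgue_integrable lborel (ereal v) (ereal u) (f s)"
      "interval_lebesgue_integrable lborel (ereal v) (ereal u) (f' t)"
      using that by (auto intro!: interval_integrable_continuous_on continuous_on_subset[OF cont(1)] continuous_on_subset[OF cont(2)])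
    have "(primitive f s u - primitive f s v) - (primitive f' t u - primitive f' t v) = (LBINT \<xi>=v..u. ?h \<xi>)"
      using interval_lebesgue_integral_diff(2)[OF i] interval_integral_primitive[of f] interval_integral_primitive[of f'] cont by simp
    also have "\<dots> = integral {v..u} ?h"
      using that c by (intro interval_integral_eq_integral borel_integrable_atLeastAtMost') auto
    also have "norm \<dots> \<le> B * (u - v)"
      using that bound c by (intro integral_bound) auto
    finally show ?thesis by simp
  qed
  show ?thesis
    using *[of v u] *[of u v] uv by (cases "v \<le> u") (auto simp: abs_minus_commute algebra_simps)
qed

lemma primitive_bound:
  fixes f :: "real \<Rightarrow> real \<Rightarrow> real"
  assumes cont: "continuous_on UNIV (f t)"
    and bound: "\<And>\<xi>. \<xi> \<in> {-R..R} \<Longrightarrow> \<bar>f t \<xi>\<bar> \<le> B"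
    and uv: "u \<in> {-R..R}" "v \<in> {-R..R}"
  shows "\<bar>primitive f t u - primitive f t v\<bar> \<le> B * \<bar>u - v\<bar>"
  using primitive_difference_bound[of f t "\<lambda>_ _. 0" t R B u v] assms by (simp add: primitive_def)

lemma controlled_primitiveI:
  assumes "\<And>t. t \<in> {0..b} \<Longrightarrow> continuous_on UNIV (f t)"
    and "\<And>t \<xi>. \<lbrakk>t \<in> {0..b}; \<xi> \<in> {-R..R}\<rbrakk> \<Longrightarrow> \<bar>f t \<xi>\<bar> \<le> B"
    and "\<And>s t \<xi>. \<lbrakk>s \<in> {0..b}; t \<in> {0..b}; \<bar>s - t\<bar> \<le> \<eta>; \<xi> \<in> {-R..R}\<rbrakk> \<Longrightarrow> \<bar>f s \<xi> - f t \<xi>\<bar> \<le> \<Lambda> * \<bar>s - t\<bar> powr \<rho>"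
  shows "controlled_primitive (primitive f) b \<eta> R B \<Lambda> \<rho>"
  unfolding controlled_primitive_def
  by (intro conjI ballI impI primitive_bound primitive_difference_bound assms)

lemma level_indices_0:
  assumes "0 \<le> t" "t \<le> 1" "1 \<le> k"
  shows "level_indices 0 t k = {..<2 * nat \<lfloor>t * 2 ^ (k - 1)\<rfloor>}"
proof -
  define N where "N = nat \<lfloor>t * 2 ^ (k - 1)\<rfloor>"
  have N: "m \<le> N \<longleftrightarrow> real m \<le> t * 2 ^ (k - 1)" for m
    unfolding N_def using assms(1) by (simp add: le_nat_iff le_floor_iff)
  have iff: "{dyadic (k - 1) (n div 2)..dyadic (k - 1) (n div 2 + 1)} \<subseteq> {0..t} \<longleftrightarrow> n < 2 * N" for n
  proof -
    have "dyadic (k - 1) (n div 2) \<le> dyadic (k - 1) (n div 2 + 1)" by (rule dyadic_mono) simp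
    then have "{dyadic (k - 1) (n div 2)..dyadic (k - 1) (n div 2 + 1)} \<subseteq> {0..t}
        \<longleftrightarrow> dyadic (k - 1) (n div 2 + 1) \<le> t" by auto
    also have "\<dots> \<longleftrightarrow> n div 2 + 1 \<le> N" unfolding dyadic_le_iff N ..
    also have "\<dots> \<longleftrightarrow> n < 2 * N" by linarith
    finally show ?thesis .
  qed
  have "2 * N \<le> 2 ^ k"
  proof -
    have "real N \<le> t * 2 ^ (k - 1)" using N[of N] by simp
    also have "\<dots> \<le> 1 * 2 ^ (k - 1)" using assms by (intro mult_right_mono) auto
    finally have "N \<le> 2 ^ (k - 1)" by simp
    then have "2 * N \<le> 2 * 2 ^ (k - 1)" by simp
    also have "\<dots> = 2 ^ k" using assms(3) by (cases k) auto
    finally show ?thesis .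
  qed
  then show ?thesis
    unfolding level_indices_def N_def[symmetric] iff by auto
qed

lemma level_sum_eq_running_sum:
  assumes "0 \<le> t" "t \<le> 1" "1 \<le> k"
    and cont: "\<And>s. s \<in> {0..t} \<Longrightarrow> continuous_on UNIV (f s)"
  shows "level_sum f g 0 t k = running_sum (primitive f) g t k"
proof -
  define N where "N = nat \<lfloor>t * 2 ^ (k - 1)\<rfloor>"
  note ind = level_indices_0[OF assms(1-3), folded N_def]
  have path: "running_sum (primitive f) g t k = jump_sum (primitive f) g k (2 * N)"
    by (simp add: running_sum_def N_def)
  show ?thesis
  proof (cases "N = 0")
    case True
    then show ?thesis by (simp add: level_sum_def ind path jump_sum_def)
  next
    case False
    have MM: "Min {..<2 * N} = 0" "Max {..<2 * N} = 2 * N - 1"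
      by (rule Min_eqI; use False in simp) (rule Max_eqI; use False in auto)
    have set: "{Min {..<2 * N} + 1..Max {..<2 * N}} = {1..<2 * N}"
      unfolding MM using False by auto
    have "(LBINT \<xi>=avg g k (n - 1)..avg g k n. f (dyadic k n) \<xi>)
      = primitive f (dyadic k n) (avg g k n) - primitive f (dyadic k n) (avg g k (n - 1))"
      if n: "n \<in> {1..<2 * N}" for n
    proof (rule interval_integral_primitive[OF cont])
      have "dyadic k n \<le> dyadic k (2 * N)" using n by (intro dyadic_mono) auto
      also have "\<dots> = dyadic (k - 1) N" using dyadic_double[of "k - 1" N] assms(3) by simp
      also have "\<dots> \<le> t" unfolding N_def by (rule dyadic_floor_le) fact
      finally show "dyadic k n \<in> {0..t}" by simp
    qed
    then show ?thesis
      using False unfolding level_sum_def ind path jump_sum_def set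
      by (simp add: lessThan_empty_iff bot_nat_def)
  qed
qed

lemma eventually_level_sum:
  assumes "0 \<le> t" "t \<le> 1" "\<And>s. s \<in> {0..t} \<Longrightarrow> continuous_on UNIV (f s)"
  shows "\<forall>\<^sub>F k in sequentially. running_sum (primitive f) g t k = level_sum f g 0 t k"
  using eventually_ge_at_top[of 1]
proof eventually_elim
  case (elim k)
  then show ?case by (intro level_sum_eq_running_sum[symmetric] assms) auto
qed

lemma path_integral_running_sum:
  assumes "0 \<le> t" "t \<le> 1" "\<And>s. s \<in> {0..t} \<Longrightarrow> continuous_on UNIV (f s)"
  shows "path_integral f g 0 t = lim (running_sum (primitive f) g t)"
    and "path_integrable f g 0 t \<longleftrightarrow> convergent (running_sum (primitive f) g t)"
proof -
  have "running_sum (primitive f) g t \<longlonglongrightarrow> c \<longleftrightarrow> level_sum f g 0 t \<longlonglongrightarrow> c" for c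
    by (intro tendsto_cong eventually_level_sum assms) auto
  then show "path_integral f g 0 t = lim (running_sum (primitive f) g t)"
    and "path_integrable f g 0 t \<longleftrightarrow> convergent (running_sum (primitive f) g t)"
    by (simp_all add: path_integral_def path_integrable_def lim_def convergent_def)
qed

context dyadic_rough_path
begin

context
  fixes f :: "real \<Rightarrow> real \<Rightarrow> real" and b B \<Lambda> \<rho> :: real
  assumes b: "b \<in> {0..T}" and B_nonneg: "0 \<le> B" and Lam_nonneg: "0 \<le> \<Lambda>" and rho: "\<beta>\<^sub>0 < \<rho>"
    and cont: "\<And>t. t \<in> {0..b} \<Longrightarrow> continuous_on UNIV (f t)"
    and bound: "\<And>t \<xi>. \<lbrakk>t \<in> {0..b}; \<xi> \<in> {-R..R}\<rbrakk> \<Longrightarrow> \<bar>f t \<xi>\<bar> \<le> B"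
begin

text \<open>
  The rate is uniform over all integrands with the same \<open>B\<close> and \<open>\<Lambda>\<close>; this is what makes the
  integral continuous in the integrand later on.
\<close>

lemma path_integral_exists:
  assumes time: "\<And>s t \<xi>. \<lbrakk>s \<in> {0..b}; t \<in> {0..b}; \<xi> \<in> {-R..R}\<rbrakk> \<Longrightarrow> \<bar>f s \<xi> - f t \<xi>\<bar> \<le> \<Lambda> * \<bar>s - t\<bar> powr \<rho>"
  defines "q \<equiv> max (2 powr - \<alpha>) (2 powr - (\<rho> - \<beta>\<^sub>0))"
  shows "path_integrable f g 0 b"
    and "0 < b \<Longrightarrow> first_level b \<le> k \<Longrightarrow>
      \<bar>level_sum f g 0 b k - path_integral f g 0 b\<bar> \<le> (6 * B * H + \<Lambda> * G) * q ^ k / (1 - q)"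
proof -
  have ctrl: "controlled_primitive (primitive f) b b R B \<Lambda> \<rho>"
    using cont bound time by (intro controlled_primitiveI)
  have bT: "b \<le> T" using b by simp
  have b01: "0 \<le> b" "b \<le> 1" using b T_le_1 by auto
  have lim: "path_integral f g 0 b = lim (running_sum (primitive f) g b)"
    "path_integrable f g 0 b \<longleftrightarrow> convergent (running_sum (primitive f) g b)"
    using b01 cont by (intro path_integral_running_sum; auto)+
  note conv = running_sum_converges[OF ctrl bT B_nonneg Lam_nonneg rho _ order_refl]
  have "convergent (running_sum (primitive f) g b)"
  proof (cases "b = 0")
    case True
    then have "running_sum (primitive f) g b = (\<lambda>_. 0)"
      by (auto simp: running_sum_def jump_sum_def)
    then show ?thesis by (simp add: convergent_const)
  next
    case False
    then show ?thesis using conv(1) b by simp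
  qed
  then show "path_integrable f g 0 b" by (simp add: lim)
  show "0 < b \<Longrightarrow> first_level b \<le> k \<Longrightarrow>
      \<bar>level_sum f g 0 b k - path_integral f g 0 b\<bar> \<le> (6 * B * H + \<Lambda> * G) * q ^ k / (1 - q)"
    using conv(2)[of k] level_sum_eq_running_sum[of b k f g] cont b T_le_1
    by (simp add: lim first_level_def q_def)
qed

text \<open>
  The limit of \<open>level_increment_bound\<close>. Time regularity is needed at distances up to \<open>b - a\<close> only,
  so existence of the two integrals is a separate hypothesis.
\<close>

lemma path_integral_increment:
  assumes time: "\<And>s t \<xi>. \<lbrakk>s \<in> {0..b}; t \<in> {0..b}; \<bar>s - t\<bar> \<le> b - a; \<xi> \<in> {-R..R}\<rbrakk> \<Longrightarrow>
      \<bar>f s \<xi> - f t \<xi>\<bar> \<le> \<Lambda> * \<bar>s - t\<bar> powr \<rho>"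
    and integrable: "path_integrable f g 0 a" "path_integrable f g 0 b"
    and a: "0 \<le> a" "a < b"
  shows "\<bar>path_integral f g 0 b - path_integral f g 0 a\<bar>
    \<le> (6 + 6 / (1 - 2 powr - \<alpha>)) * (B * H) * (b - a) powr \<alpha> + \<Lambda> * G * (b - a) powr (\<rho> + \<gamma>)" (is "_ \<le> ?bd")
proof -
  have ctrl: "controlled_primitive (primitive f) b (b - a) R B \<Lambda> \<rho>"
    using cont bound time by (intro controlled_primitiveI)
  have bT: "b \<le> T" using b by simp
  have lim: "running_sum (primitive f) g c \<longlonglongrightarrow> path_integral f g 0 c"
    if "c \<in> {0..b}" "path_integrable f g 0 c" for c
  proof -
    have "path_integral f g 0 c = lim (running_sum (primitive f) g c)"
      "path_integrable f g 0 c \<longleftrightarrow> convergent (running_sum (primitive f) g c)"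
      using that(1) b T_le_1 cont by (intro path_integral_running_sum; auto)+
    then show ?thesis using that(2) by (simp add: convergent_LIMSEQ_iff)
  qed
  have "(\<lambda>n. \<bar>running_sum (primitive f) g b n - running_sum (primitive f) g a n\<bar>)
      \<longlonglongrightarrow> \<bar>path_integral f g 0 b - path_integral f g 0 a\<bar>"
    using a b integrable by (intro tendsto_intros lim) auto
  then show ?thesis
  proof (rule LIMSEQ_le_const2, intro exI allI impI)
    fix n assume "first_level (b - a) \<le> n"
    then show "\<bar>running_sum (primitive f) g b n - running_sum (primitive f) g a n\<bar> \<le> ?bd"
      using level_increment_bound[OF ctrl bT B_nonneg Lam_nonneg rho a order_refl, of "n - first_level (b - a)"]
      by simp
  qed
qed

end

end

text \<open>
  Partial sums of \<open>mu\<close>, with the division in \<open>ennreal\<close> cleared.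
\<close>

lemma G_norm_variation:
  fixes x :: "real \<Rightarrow> real ^ 'd::finite"
  assumes G: "G_norm \<beta>\<^sub>0 \<gamma> T x \<le> ennreal G" "0 \<le> G" and ab: "0 \<le> a" "a < b" "b \<le> T"
  shows "(\<Sum>k\<in>{first_level (b - a)..<first_level (b - a) + n}.
     2 powr (- (real (k + 1) * \<beta>\<^sub>0)) * dyadic_variation (\<lambda>t. x t $ j) a b k) \<le> G * (b - a) powr (\<beta>\<^sub>0 + \<gamma>)"
proof -
  let ?g = "\<lambda>t. x t $ j"
  let ?c = "(b - a) powr (\<beta>\<^sub>0 + \<gamma>)"
  define K where "K = first_level (b - a)"
  define W where "W k = 2 powr (- (real (k + 1) * \<beta>\<^sub>0)) * dyadic_variation ?g a b k" for k
  have W: "0 \<le> W k" for k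
    unfolding W_def dyadic_variation_def by (intro mult_nonneg_nonneg sum_nonneg) auto
  have c: "0 < ?c" using ab by simp
  have "mu ?g a b \<beta>\<^sub>0 / ennreal ?c \<le> ennreal G"
  proof (rule order_trans[OF _ G(1)])
    show "mu ?g a b \<beta>\<^sub>0 / ennreal ?c \<le> G_norm \<beta>\<^sub>0 \<gamma> T x"
      unfolding G_norm_def using ab by (intro SUP_upper2[of "(a, b, j)"]) auto
  qed
  then have "mu ?g a b \<beta>\<^sub>0 / ennreal ?c * ennreal ?c \<le> ennreal G * ennreal ?c"
    by (rule mult_right_mono) simp
  then have mu: "mu ?g a b \<beta>\<^sub>0 \<le> ennreal (G * ?c)"
    using c G(2) by (simp add: ennreal_divide_times ennreal_mult)
  have "mu ?g a b \<beta>\<^sub>0 = (\<Sum>i. ennreal (W (K + i)))"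
    by (simp add: mu_def Let_def W_def K_def first_level_def dyadic_variation_def)
  then have "(\<Sum>i<n. ennreal (W (K + i))) \<le> ennreal (G * ?c)"
    using mu sum_le_suminf[of "\<lambda>i. ennreal (W (K + i))" "{..<n}"] by auto
  then have "ennreal (\<Sum>i<n. W (K + i)) \<le> ennreal (G * ?c)"
    using W by (simp add: sum_ennreal)
  then have "(\<Sum>i<n. W (K + i)) \<le> G * ?c"
    using G(2) c by (simp add: ennreal_le_iff)
  moreover have "(\<Sum>k\<in>{K..<K + n}. W k) = (\<Sum>i<n. W (K + i))"
    using sum.shift_bounds_nat_ivl[of W 0 K n] by (simp add: add.commute atLeast0LessThan)
  ultimately show ?thesis by (simp add: W_def K_def)
qed

text \<open>
  A level sum over \<open>{0..t}\<close> evaluates the integrand at times up to \<open>t\<close> only. Hence the integral up to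
  \<open>t\<close> does not see the future, which is what makes the delayed equation solvable.
\<close>

lemma running_sum_dyadic_le:
  assumes "0 \<le> t" "1 \<le> k" "n < 2 * nat \<lfloor>t * 2 ^ (k - 1)\<rfloor>"
  shows "dyadic k (n + 1) \<le> t"
proof -
  have "dyadic k (n + 1) \<le> dyadic k (2 * nat \<lfloor>t * 2 ^ (k - 1)\<rfloor>)" using assms by (intro dyadic_mono) auto
  also have "\<dots> = dyadic (k - 1) (nat \<lfloor>t * 2 ^ (k - 1)\<rfloor>)"
    using dyadic_double[of "k - 1"] assms(2) by simp
  also have "\<dots> \<le> t" using assms(1) by (rule dyadic_floor_le)
  finally show ?thesis .
qed

lemma running_sum_cong:
  assumes "0 \<le> t" "1 \<le> k" "\<And>s. s \<in> {0..t} \<Longrightarrow> \<Phi> s = \<Psi> s"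
  shows "running_sum \<Phi> g t k = running_sum \<Psi> g t k"
  unfolding running_sum_def jump_sum_def
proof (rule sum.cong[OF refl])
  fix n assume n: "n \<in> {1..<2 * nat \<lfloor>t * 2 ^ (k - 1)\<rfloor>}"
  then have "dyadic k n \<le> t"
    using running_sum_dyadic_le[of t k n] dyadic_mono[of n "n + 1" k] assms by auto
  then have "\<Phi> (dyadic k n) = \<Psi> (dyadic k n)" using assms(3) by simp
  then show "\<Phi> (dyadic k n) (avg g k n) - \<Phi> (dyadic k n) (avg g k (n - 1)) =
    \<Psi> (dyadic k n) (avg g k n) - \<Psi> (dyadic k n) (avg g k (n - 1))" by simp
qed

lemma path_integral_cong:
  assumes "0 \<le> t" "t \<le> 1" "\<And>s. s \<in> {0..t} \<Longrightarrow> continuous_on UNIV (f s)"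
    and eq: "\<And>s. s \<in> {0..t} \<Longrightarrow> f s = f' s"
  shows "path_integral f g 0 t = path_integral f' g 0 t"
proof -
  have "\<forall>\<^sub>F k in sequentially. running_sum (primitive f) g t k = running_sum (primitive f') g t k"
    using eventually_ge_at_top[of 1]
    by eventually_elim (use assms in \<open>auto intro!: running_sum_cong simp: primitive_def fun_eq_iff\<close>)
  from tendsto_cong[OF this] have "lim (running_sum (primitive f) g t) = lim (running_sum (primitive f') g t)"
    by (simp add: lim_def)
  moreover have "path_integral f' g 0 t = lim (running_sum (primitive f') g t)"
    using assms(3) eq by (intro path_integral_running_sum assms) metis
  moreover have "path_integral f g 0 t = lim (running_sum (primitive f) g t)"
    by (intro path_integral_running_sum assms)
  ultimately show ?thesis by simp
qed

lemma path_integral_0: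
  assumes "continuous_on UNIV (f 0)"
  shows "path_integral f g 0 0 = 0"
proof -
  have "running_sum (primitive f) g 0 = (\<lambda>_. 0)" by (auto simp: running_sum_def jump_sum_def)
  then show ?thesis using path_integral_running_sum(1)[of 0 f g] assms by (simp add: limI)
qed

text \<open>
  Limits in \<open>n\<close> and in the level \<open>k\<close> commute when the level sums converge uniformly in \<open>n\<close>.
\<close>

lemma limit_interchange:
  fixes S :: "nat \<Rightarrow> nat \<Rightarrow> real"
  assumes tail: "\<And>n k. K \<le> k \<Longrightarrow> \<bar>S n k - I n\<bar> \<le> D k" "\<And>k. K \<le> k \<Longrightarrow> \<bar>s k - i\<bar> \<le> D k"
    and D: "D \<longlonglongrightarrow> 0" and level: "\<And>k. K \<le> k \<Longrightarrow> (\<lambda>n. S n k) \<longlonglongrightarrow> s k"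
  shows "I \<longlonglongrightarrow> i"
proof (rule LIMSEQ_I)
  fix e :: real assume e: "0 < e"
  have "\<forall>\<^sub>F k in sequentially. D k < e / 3 \<and> K \<le> k"
    using D e eventually_ge_at_top[of K] by (intro eventually_conj order_tendstoD(2)) auto
  then obtain k where k: "D k < e / 3" "K \<le> k" by (auto simp: eventually_sequentially)
  from LIMSEQ_D[OF level[OF k(2)], of "e / 3"] e
  obtain n0 where n0: "\<And>n. n0 \<le> n \<Longrightarrow> norm (S n k - s k) < e / 3" by auto
  show "\<exists>n0. \<forall>n\<ge>n0. norm (I n - i) < e"
  proof (intro exI allI impI)
    fix n assume "n0 \<le> n"
    from n0[OF this] tail(1)[OF k(2), of n] tail(2)[OF k(2)] k(1)
    show "norm (I n - i) < e" unfolding real_norm_def by linarith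
  qed
qed

section \<open>The integral operator of the equation\<close>

text \<open>
  The driver with common constants for all coordinates, and the coefficients only through their
  component integrands: linear growth in \<open>y\<close>, and joint regularity in time and solution. The time
  exponent is \<open>\<theta> * \<beta>\<close>, since a \<open>\<beta>\<close>-Hoelder solution and the other coordinates of the driver enter
  with the power \<open>\<theta>\<close>.
\<close>

locale rough_system =
  fixes F :: "real \<Rightarrow> real ^ 'm::finite \<Rightarrow> real ^ 'd::finite \<Rightarrow> real ^ 'd ^ 'm"
    and x :: "real \<Rightarrow> real ^ 'd" and T \<alpha> H R \<beta>\<^sub>0 \<gamma> G \<beta> \<theta> L :: real
  assumes driver: "\<And>j. dyadic_rough_path (\<lambda>t. x t $ j) T \<alpha> H R \<beta>\<^sub>0 \<gamma> G"
    and T_nonneg: "0 \<le> T"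
    and beta: "0 < \<beta>" "\<beta> \<le> \<alpha>" and theta: "0 < \<theta>" "\<theta> \<le> 1" and L: "1 \<le> L"
    and rates: "\<beta>\<^sub>0 < \<theta> * \<beta>" "\<beta> - \<gamma> < \<beta>\<^sub>0"
    and integrand_continuous:
      "\<And>y i j t. t \<in> {0..T} \<Longrightarrow> continuous_on UNIV (component_integrand F y x i j t)"
    and integrand_growth:
      "\<And>y i j t \<xi>. \<lbrakk>t \<in> {0..T}; \<xi> \<in> {-R..R}\<rbrakk> \<Longrightarrow>
         \<bar>component_integrand F y x i j t \<xi>\<bar> \<le> L * (1 + norm (y t))"
    and integrand_holder:
      "\<And>y y' i j s t \<xi>. \<lbrakk>s \<in> {0..T}; t \<in> {0..T}; \<xi> \<in> {-R..R}\<rbrakk> \<Longrightarrow>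
         \<bar>component_integrand F y x i j s \<xi> - component_integrand F y' x i j t \<xi>\<bar>
           \<le> L * (\<bar>s - t\<bar> powr (\<theta> * \<beta>) + norm (y s - y' t) powr \<theta>)"
begin

lemma T_le_1: "T \<le> 1" and H_nonneg: "0 \<le> H" and G_nonneg: "0 \<le> G" and alpha_pos: "0 < \<alpha>"
  using driver[of undefined] by (auto simp: dyadic_rough_path_def holder_path_def dyadic_rough_path_axioms_def)

text \<open>
  The Hoelder bound is restricted to distances up to \<open>\<eta>\<close>, as in \<open>controlled_primitive\<close>.
\<close>

definition holder_bounded :: "real \<Rightarrow> real \<Rightarrow> real \<Rightarrow> real \<Rightarrow> (real \<Rightarrow> real ^ 'm) \<Rightarrow> bool" where
  "holder_bounded b \<eta> N M y \<longleftrightarrow> (\<forall>t\<in>{0..b}. norm (y t) \<le> N) \<and>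
     (\<forall>s\<in>{0..b}. \<forall>t\<in>{0..b}. \<bar>s - t\<bar> \<le> \<eta> \<longrightarrow> norm (y s - y t) \<le> M * \<bar>s - t\<bar> powr \<beta>)"

lemma holder_bounded_nonneg:
  assumes "holder_bounded b \<eta> N M y" "0 \<le> b" shows "0 \<le> N"
  using assms order_trans[OF norm_ge_zero, of "y 0" N] by (auto simp: holder_bounded_def)

lemma integrand_bound:
  assumes "holder_bounded b \<eta> N M y" "b \<le> T" "t \<in> {0..b}" "\<xi> \<in> {-R..R}"
  shows "\<bar>component_integrand F y x i j t \<xi>\<bar> \<le> L * (1 + N)"
proof -
  have "L * (1 + norm (y t)) \<le> L * (1 + N)"
    using assms L by (intro mult_left_mono) (auto simp: holder_bounded_def)
  then show ?thesis using integrand_growth[of t \<xi> y i j] assms by auto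
qed

lemma integrand_time_holder:
  assumes y: "holder_bounded b \<eta> N M y" and M: "0 \<le> M" and b: "b \<le> T"
    and st: "s \<in> {0..b}" "t \<in> {0..b}" "\<bar>s - t\<bar> \<le> \<eta>" and xi: "\<xi> \<in> {-R..R}"
  shows "\<bar>component_integrand F y x i j s \<xi> - component_integrand F y x i j t \<xi>\<bar>
    \<le> L * (1 + M powr \<theta>) * \<bar>s - t\<bar> powr (\<theta> * \<beta>)"
proof -
  have "norm (y s - y t) powr \<theta> \<le> (M * \<bar>s - t\<bar> powr \<beta>) powr \<theta>"
    using y st theta by (intro powr_mono2) (auto simp: holder_bounded_def)
  also have "\<dots> = M powr \<theta> * \<bar>s - t\<bar> powr (\<theta> * \<beta>)"
    using M by (simp add: powr_mult powr_powr mult.commute)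
  finally have "L * (\<bar>s - t\<bar> powr (\<theta> * \<beta>) + norm (y s - y t) powr \<theta>)
    \<le> L * (\<bar>s - t\<bar> powr (\<theta> * \<beta>) + M powr \<theta> * \<bar>s - t\<bar> powr (\<theta> * \<beta>))"
    using L by (intro mult_left_mono) auto
  then show ?thesis
    using integrand_holder[of s t \<xi> y i j y] st xi b by (auto simp: distrib_left distrib_right mult.assoc)
qed

definition tail_rate :: real where
  "tail_rate = max (2 powr - \<alpha>) (2 powr - (\<theta> * \<beta> - \<beta>\<^sub>0))"

lemma tail_rate: "0 < tail_rate" "tail_rate < 1"
  using alpha_pos rates unfolding tail_rate_def less_max_iff_disj max_less_iff_conj by (auto simp: powr_less_one)

lemma component_integral:
  assumes y: "holder_bounded T T N M y" and M: "0 \<le> M" and b: "b \<in> {0..T}"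
  shows "path_integrable (component_integrand F y x i j) (\<lambda>t. x t $ j) 0 b"
    and "\<lbrakk>0 < b; first_level b \<le> k\<rbrakk> \<Longrightarrow>
      \<bar>level_sum (component_integrand F y x i j) (\<lambda>t. x t $ j) 0 b k
        - path_integral (component_integrand F y x i j) (\<lambda>t. x t $ j) 0 b\<bar>
      \<le> (6 * (L * (1 + N)) * H + L * (1 + M powr \<theta>) * G) * tail_rate ^ k / (1 - tail_rate)"
proof -
  interpret dyadic_rough_path "\<lambda>t. x t $ j" T \<alpha> H R \<beta>\<^sub>0 \<gamma> G by (rule driver)
  have N: "0 \<le> N" using holder_bounded_nonneg[OF y T_nonneg] .
  have c: "continuous_on UNIV (component_integrand F y x i j t)" if "t \<in> {0..b}" for t
    using that b by (intro integrand_continuous) auto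
  have bd: "\<bar>component_integrand F y x i j t \<xi>\<bar> \<le> L * (1 + N)" if "t \<in> {0..b}" "\<xi> \<in> {-R..R}" for t \<xi>
    using that b by (intro integrand_bound[OF y order_refl]) auto
  have h: "\<bar>component_integrand F y x i j s \<xi> - component_integrand F y x i j t \<xi>\<bar>
    \<le> L * (1 + M powr \<theta>) * \<bar>s - t\<bar> powr (\<theta> * \<beta>)" if "s \<in> {0..b}" "t \<in> {0..b}" "\<xi> \<in> {-R..R}" for s t \<xi>
    using that b by (intro integrand_time_holder[OF y M order_refl]) auto
  have nonneg: "0 \<le> L * (1 + N)" "0 \<le> L * (1 + M powr \<theta>)" using L N by auto
  note * = path_integral_exists[OF b nonneg rates(1) c bd h]
  show "path_integrable (component_integrand F y x i j) (\<lambda>t. x t $ j) 0 b"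
    by (rule *(1))
  show "\<bar>level_sum (component_integrand F y x i j) (\<lambda>t. x t $ j) 0 b k
        - path_integral (component_integrand F y x i j) (\<lambda>t. x t $ j) 0 b\<bar>
      \<le> (6 * (L * (1 + N)) * H + L * (1 + M powr \<theta>) * G) * tail_rate ^ k / (1 - tail_rate)"
    if "0 < b" "first_level b \<le> k"
    unfolding tail_rate_def by (rule *(2)) (use that in auto)
qed

definition increment_const :: real where
  "increment_const = 1 + real CARD('m) * (real CARD('d) * (L * ((6 + 6 / (1 - 2 powr - \<alpha>)) * H + 2 * G)))"

lemma increment_const: "1 \<le> increment_const"
proof -
  have "2 powr - \<alpha> < 1" using alpha_pos by (simp add: powr_less_one)
  then show ?thesis using L H_nonneg G_nonneg by (simp add: increment_const_def)
qed

text \<open>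
  The key estimate. The sup norm \<open>N\<close> comes with the exponent \<open>\<beta>\<close> itself, and the Hoelder constant
  \<open>M\<close> with the exponent \<open>\<theta> * \<beta> + \<gamma>\<close>, which exceeds \<open>\<beta>\<close>: on short intervals the contribution of \<open>M\<close> is
  negligible, so Hoelder bounds can be closed. Both enter linearly, since \<open>M powr \<theta> \<le> 1 + M\<close>.
\<close>

lemma vector_integral_increment:
  assumes y: "holder_bounded b (b - a) N M y" and M: "0 \<le> M" and ab: "0 \<le> a" "a < b" "b \<le> T"
    and int: "vector_path_integrable F y x 0 a" "vector_path_integrable F y x 0 b"
  shows "norm (vector_path_integral F y x 0 b - vector_path_integral F y x 0 a)
    \<le> increment_const * ((1 + N) * (b - a) powr \<beta> + (1 + M) * (b - a) powr (\<theta> * \<beta> + \<gamma>))"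
proof -
  define E where "E = (1 + N) * (b - a) powr \<beta> + (1 + M) * (b - a) powr (\<theta> * \<beta> + \<gamma>)"
  define c where "c = 6 + 6 / (1 - 2 powr - \<alpha>)"
  let ?I = "\<lambda>i j t. path_integral (component_integrand F y x i j) (\<lambda>t. x t $ j) 0 t"
  have "2 powr - \<alpha> < 1" using alpha_pos by (simp add: powr_less_one)
  then have c: "0 \<le> c" by (simp add: c_def)
  have N: "0 \<le> N" using holder_bounded_nonneg[OF y] ab by auto
  have E: "0 \<le> E" using N M by (simp add: E_def)
  have comp: "\<bar>?I i j b - ?I i j a\<bar> \<le> L * (c * H + 2 * G) * E" for i j
  proof -
    interpret dyadic_rough_path "\<lambda>t. x t $ j" T \<alpha> H R \<beta>\<^sub>0 \<gamma> G by (rule driver)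
    have b: "b \<in> {0..T}" using ab by auto
    have cont: "continuous_on UNIV (component_integrand F y x i j t)" if "t \<in> {0..b}" for t
      using that b by (intro integrand_continuous) auto
    have "\<bar>?I i j b - ?I i j a\<bar> \<le> (6 + 6 / (1 - 2 powr - \<alpha>)) * (L * (1 + N) * H) * (b - a) powr \<alpha>
        + L * (1 + M powr \<theta>) * G * (b - a) powr (\<theta> * \<beta> + \<gamma>)"
      by (rule path_integral_increment[OF b _ _ rates(1) cont])
         (use ab L N M int y in \<open>auto simp: vector_path_integrable_def simp del: atLeastAtMost_iff
            intro!: integrand_bound integrand_time_holder\<close>)
    also have "\<dots> \<le> c * (L * (1 + N) * H) * (b - a) powr \<beta> + L * (2 * (1 + M)) * G * (b - a) powr (\<theta> * \<beta> + \<gamma>)"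
    proof -
      have "(b - a) powr \<alpha> \<le> (b - a) powr \<beta>"
        using ab beta T_le_1 by (intro powr_mono') auto
      moreover have "1 + M powr \<theta> \<le> 2 * (1 + M)"
      proof -
        have "M powr \<theta> \<le> (1 + M) powr \<theta>" using M theta by (intro powr_mono2) auto
        also have "\<dots> \<le> (1 + M) powr 1" using M theta by (intro powr_mono) auto
        finally show ?thesis using M by simp
      qed
      ultimately show ?thesis unfolding c_def[symmetric]
        using c L N M H_nonneg G_nonneg
        by (intro add_mono mult_left_mono mult_right_mono) auto
    qed
    also have "\<dots> = L * (c * H) * ((1 + N) * (b - a) powr \<beta>) + L * (2 * G) * ((1 + M) * (b - a) powr (\<theta> * \<beta> + \<gamma>))"
      by (simp add: algebra_simps)
    also have "\<dots> \<le> L * (c * H) * E + L * (2 * G) * E"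
      unfolding E_def using c L N M H_nonneg G_nonneg by (intro add_mono mult_left_mono) auto
    finally show ?thesis by (simp add: algebra_simps)
  qed
  have "norm (vector_path_integral F y x 0 b - vector_path_integral F y x 0 a)
      \<le> (\<Sum>i\<in>UNIV. \<bar>\<Sum>j\<in>UNIV. ?I i j b - ?I i j a\<bar>)"
    using norm_le_l1_cart[of "vector_path_integral F y x 0 b - vector_path_integral F y x 0 a"]
    by (simp add: vector_path_integral_def sum_subtractf)
  also have "\<dots> \<le> (\<Sum>i\<in>(UNIV :: 'm set). \<Sum>j\<in>(UNIV :: 'd set). L * (c * H + 2 * G) * E)"
    by (intro sum_mono order_trans[OF sum_abs] comp)
  also have "\<dots> = (increment_const - 1) * E"
    by (simp add: increment_const_def c_def mult.assoc)
  also have "\<dots> \<le> increment_const * E" using E by (simp add: left_diff_distrib)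
  finally show ?thesis by (simp add: E_def)
qed

end

section \<open>An invariant class of paths\<close>

context rough_system
begin

definition picard :: "real ^ 'm \<Rightarrow> (real \<Rightarrow> real ^ 'm) \<Rightarrow> real \<Rightarrow> real ^ 'm" where
  "picard y0 y t = y0 + vector_path_integral F y x 0 t"

text \<open>
  Both bounds grow by a factor \<open>2\<close> every \<open>\<delta>\<close> units of time. With linear growth of the coefficients the
  integral operator need not preserve a bound that is constant in time, but it preserves these for a
  step \<open>\<delta>\<close> that does not depend on the size of the path.
\<close>

definition tempered :: "real \<Rightarrow> real \<Rightarrow> real \<Rightarrow> (real \<Rightarrow> real ^ 'm) \<Rightarrow> bool" where
  "tempered \<delta> A A' y \<longleftrightarrow> (\<forall>t\<in>{0..T}. norm (y t) \<le> A * 2 powr (t / \<delta>)) \<and>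
     (\<forall>a\<in>{0..T}. \<forall>b\<in>{0..T}. a \<le> b \<longrightarrow> b - a \<le> \<delta> \<longrightarrow>
        norm (y b - y a) \<le> A' * 2 powr (b / \<delta>) * (b - a) powr \<beta>)"

lemma two_powr_mono: "0 < \<delta> \<Longrightarrow> s \<le> t \<Longrightarrow> (2::real) powr (s / \<delta>) \<le> 2 powr (t / \<delta>)"
  by (intro powr_mono divide_right_mono) auto

lemma tempered_holder_bounded_local:
  assumes y: "tempered \<delta> A A' y" and pos: "0 < \<delta>" "0 \<le> A" "0 \<le> A'" and b: "b \<le> T" "\<eta> \<le> \<delta>"
  shows "holder_bounded b \<eta> (A * 2 powr (b / \<delta>)) (A' * 2 powr (b / \<delta>)) y"
proof -
  have step: "norm (y t - y s) \<le> A' * 2 powr (b / \<delta>) * \<bar>t - s\<bar> powr \<beta>"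
    if "s \<in> {0..b}" "t \<in> {0..b}" "\<bar>t - s\<bar> \<le> \<eta>" "s \<le> t" for s t
  proof -
    have "norm (y t - y s) \<le> A' * 2 powr (t / \<delta>) * (t - s) powr \<beta>"
      using y that b unfolding tempered_def by auto
    also have "\<dots> \<le> A' * 2 powr (b / \<delta>) * (t - s) powr \<beta>"
      using that pos by (intro mult_right_mono mult_left_mono two_powr_mono) auto
    finally show ?thesis using that by simp
  qed
  have "norm (y t) \<le> A * 2 powr (b / \<delta>)" if "t \<in> {0..b}" for t
  proof -
    have "norm (y t) \<le> A * 2 powr (t / \<delta>)" using y that b unfolding tempered_def by auto
    also have "\<dots> \<le> A * 2 powr (b / \<delta>)" using that pos by (intro mult_left_mono two_powr_mono) auto
    finally show ?thesis .
  qed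
  moreover have "norm (y s - y t) \<le> A' * 2 powr (b / \<delta>) * \<bar>s - t\<bar> powr \<beta>"
    if "s \<in> {0..b}" "t \<in> {0..b}" "\<bar>s - t\<bar> \<le> \<eta>" for s t
    using step[of s t] step[of t s] that by (cases "s \<le> t") (auto simp: abs_minus_commute norm_minus_commute)
  ultimately show ?thesis unfolding holder_bounded_def by blast
qed

lemma tempered_holder_bounded:
  assumes y: "tempered \<delta> A A' y" and pos: "0 < \<delta>" "0 \<le> A" "0 \<le> A'"
  defines "N \<equiv> A * 2 powr (T / \<delta>)"
  shows "holder_bounded T T N (A' * 2 powr (T / \<delta>) + 2 * N / \<delta> powr \<beta>) y"
proof -
  note loc = tempered_holder_bounded_local[OF y pos order_refl order_refl, folded N_def]
  have N: "0 \<le> N" using pos by (simp add: N_def)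
  have "norm (y s - y t) \<le> (A' * 2 powr (T / \<delta>) + 2 * N / \<delta> powr \<beta>) * \<bar>s - t\<bar> powr \<beta>"
    if st: "s \<in> {0..T}" "t \<in> {0..T}" for s t
  proof (cases "\<bar>s - t\<bar> \<le> \<delta>")
    case True
    then have "norm (y s - y t) \<le> A' * 2 powr (T / \<delta>) * \<bar>s - t\<bar> powr \<beta>"
      using loc st unfolding holder_bounded_def by blast
    also have "\<dots> \<le> (A' * 2 powr (T / \<delta>) + 2 * N / \<delta> powr \<beta>) * \<bar>s - t\<bar> powr \<beta>"
      using N by (intro mult_right_mono) auto
    finally show ?thesis .
  next
    case False
    then have "\<delta> powr \<beta> \<le> \<bar>s - t\<bar> powr \<beta>" using pos beta by (intro powr_mono2) auto
    then have "2 * N \<le> 2 * N / \<delta> powr \<beta> * \<bar>s - t\<bar> powr \<beta>"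
      using N pos mult_left_mono[of "\<delta> powr \<beta>" "\<bar>s - t\<bar> powr \<beta>" "2 * N"] by (simp add: field_simps)
    moreover have "norm (y s) \<le> N" "norm (y t) \<le> N" using loc st unfolding holder_bounded_def by blast+
    ultimately have "norm (y s - y t) \<le> 2 * N / \<delta> powr \<beta> * \<bar>s - t\<bar> powr \<beta>"
      using norm_triangle_ineq4[of "y s" "y t"] by linarith
    also have "\<dots> \<le> (A' * 2 powr (T / \<delta>) + 2 * N / \<delta> powr \<beta>) * \<bar>s - t\<bar> powr \<beta>"
      using pos by (intro mult_right_mono) auto
    finally show ?thesis .
  qed
  then show ?thesis using loc unfolding holder_bounded_def by blast
qed

lemma tempered_integrable:
  assumes "tempered \<delta> A A' y" "0 < \<delta>" "0 \<le> A" "0 \<le> A'" "t \<in> {0..T}"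
  shows "vector_path_integrable F y x 0 t"
  unfolding vector_path_integrable_def
  using assms by (auto intro!: component_integral(1)[OF tempered_holder_bounded[OF assms(1-4)]])

lemma picard_0: "picard y0 y 0 = y0"
  using T_nonneg by (simp add: picard_def vector_path_integral_def vec_eq_iff path_integral_0 integrand_continuous)

lemma picard_cong:
  assumes t: "t \<in> {0..T}" and eq: "\<And>s. s \<in> {0..t} \<Longrightarrow> y s = y' s"
  shows "picard y0 y t = picard y0 y' t"
proof -
  have "path_integral (component_integrand F y x i j) g 0 t = path_integral (component_integrand F y' x i j) g 0 t" for i j g
    using t T_le_1 eq
    by (intro path_integral_cong integrand_continuous) (auto simp: component_integrand_def fun_eq_iff)
  then show ?thesis by (simp add: picard_def vector_path_integral_def)
qed

text \<open>
  Over one step of length \<open>\<delta>\<close> the path moves by at most half of the bound at the end of the step, and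
  the bound at the beginning is the other half; so the sup bound follows from the Hoelder bound by
  induction on the number of steps.
\<close>

lemma exp_growth:
  fixes Y :: "real \<Rightarrow> real ^ 'm"
  assumes Y0: "norm (Y 0) \<le> A / 2" and A: "0 \<le> A" and \<delta>: "0 < \<delta>" "A' * \<delta> powr \<beta> \<le> A / 2" and A': "0 \<le> A'"
    and inc: "\<And>a b. \<lbrakk>0 \<le> a; a \<le> b; b \<le> T; b - a \<le> \<delta>\<rbrakk> \<Longrightarrow>
       norm (Y b - Y a) \<le> A' * 2 powr (b / \<delta>) * (b - a) powr \<beta>"
  shows "t \<in> {0..T} \<Longrightarrow> norm (Y t) \<le> A * 2 powr (t / \<delta>)"
proof -
  have jump: "norm (Y b - Y a) \<le> A / 2 * 2 powr (b / \<delta>)" if "0 \<le> a" "a \<le> b" "b \<le> T" "b - a \<le> \<delta>" for a b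
  proof -
    have "norm (Y b - Y a) \<le> A' * 2 powr (b / \<delta>) * (b - a) powr \<beta>" using that by (rule inc)
    also have "\<dots> \<le> A' * 2 powr (b / \<delta>) * \<delta> powr \<beta>"
      using that beta A' by (intro mult_left_mono powr_mono2) auto
    also have "\<dots> = A' * \<delta> powr \<beta> * 2 powr (b / \<delta>)" by simp
    also have "\<dots> \<le> A / 2 * 2 powr (b / \<delta>)" using \<delta>(2) by (intro mult_right_mono) auto
    finally show ?thesis .
  qed
  have "t \<in> {0..T} \<Longrightarrow> t \<le> real n * \<delta> \<Longrightarrow> norm (Y t) \<le> A * 2 powr (t / \<delta>)" for n t
  proof (induction n arbitrary: t)
    case 0
    then show ?case using Y0 A by auto
  next
    case (Suc n)
    show ?case
    proof (cases "t \<le> \<delta>")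
      case True
      have "1 \<le> 2 powr (t / \<delta>)" using Suc.prems \<delta> by (simp add: ge_one_powr_ge_zero)
      then have "A / 2 * 1 \<le> A / 2 * 2 powr (t / \<delta>)" using A by (intro mult_left_mono) auto
      then show ?thesis
        using jump[of 0 t] True Suc.prems Y0 norm_triangle_ineq2[of "Y t" "Y 0"] by auto
    next
      case False
      have "norm (Y (t - \<delta>)) \<le> A * 2 powr ((t - \<delta>) / \<delta>)"
        using Suc False \<delta> by (intro Suc.IH) (auto simp: algebra_simps)
      also have "(t - \<delta>) / \<delta> = t / \<delta> - 1" using \<delta> by (simp add: field_simps)
      also have "A * 2 powr (t / \<delta> - 1) = A / 2 * 2 powr (t / \<delta>)" by (simp add: powr_diff)
      finally show ?thesis
        using jump[of "t - \<delta>" t] False Suc.prems \<delta> norm_triangle_ineq2[of "Y t" "Y (t - \<delta>)"] by auto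
    qed
  qed
  moreover obtain n where "t / \<delta> \<le> real n" using real_arch_simple by blast
  ultimately show "t \<in> {0..T} \<Longrightarrow> norm (Y t) \<le> A * 2 powr (t / \<delta>)"
    using \<delta> by (auto simp: field_simps)
qed

text \<open>
  In \<open>vector_integral_increment\<close> put \<open>N = A * e\<close> and \<open>M = A' * e\<close> with \<open>e = 2 powr (b / \<delta>)\<close>. The first
  term is at most half of \<open>A' * e\<close> because of the choice of \<open>A'\<close>, the second because \<open>\<delta>\<close> is small, with
  a smallness that depends on \<open>increment_const\<close> only. The last condition on \<open>\<delta>\<close> yields the sup bound
  through \<open>exp_growth\<close>.
\<close>

lemma picard_tempered:
  assumes y: "tempered \<delta> A A' y" and A: "1 \<le> A" "2 * norm y0 \<le> A" and A': "A' = 4 * increment_const * A"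
    and \<delta>: "0 < \<delta>" "\<delta> powr (\<theta> * \<beta> + \<gamma> - \<beta>) \<le> 1 / (4 * increment_const)"
      "\<delta> powr \<beta> \<le> 1 / (8 * increment_const)"
  shows "tempered \<delta> A A' (picard y0 y)"
proof -
  define C where "C = increment_const"
  have C: "1 \<le> C" unfolding C_def by (rule increment_const)
  have A'1: "1 \<le> A'" unfolding A' C_def[symmetric] using C A mult_mono[of 1 C 1 A] by simp
  have inc: "norm (picard y0 y b - picard y0 y a) \<le> A' * 2 powr (b / \<delta>) * (b - a) powr \<beta>"
    if ab: "0 \<le> a" "a \<le> b" "b \<le> T" "b - a \<le> \<delta>" for a b
  proof (cases "a = b")
    case False
    then have "a < b" using ab by simp
    define e where "e = 2 powr (b / \<delta>)"
    define p where "p = (b - a) powr \<beta>"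
    have e: "1 \<le> e" using ab \<delta> by (simp add: e_def ge_one_powr_ge_zero)
    have "norm (picard y0 y b - picard y0 y a)
        \<le> C * ((1 + A * e) * p + (1 + A' * e) * (b - a) powr (\<theta> * \<beta> + \<gamma>))"
      unfolding picard_def C_def e_def p_def add_diff_cancel_left
      using ab \<open>a < b\<close> A A'1 \<delta>
      by (intro vector_integral_increment tempered_holder_bounded_local[OF y] tempered_integrable[OF y]) auto
    also have "\<dots> \<le> C * ((2 * (A * e)) * p + (2 * (A' * e)) * (1 / (4 * C) * p))"
    proof -
      have "1 \<le> A * e" "1 \<le> A' * e" using e A A'1 mult_mono[of 1 A 1 e] mult_mono[of 1 A' 1 e] by auto
      moreover have "(b - a) powr (\<theta> * \<beta> + \<gamma>) \<le> 1 / (4 * C) * p"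
      proof -
        have "(b - a) powr (\<theta> * \<beta> + \<gamma>) = (b - a) powr (\<theta> * \<beta> + \<gamma> - \<beta>) * p"
          by (simp add: p_def flip: powr_add)
        also have "\<dots> \<le> \<delta> powr (\<theta> * \<beta> + \<gamma> - \<beta>) * p"
          using ab rates by (intro mult_right_mono powr_mono2) (auto simp: p_def)
        also have "\<dots> \<le> 1 / (4 * C) * p"
          using \<delta>(2) by (intro mult_right_mono) (auto simp: p_def C_def)
        finally show ?thesis .
      qed
      ultimately show ?thesis using C
        by (intro mult_left_mono add_mono mult_mono) (auto simp: p_def)
    qed
    also have "\<dots> = A' * e * p" using C unfolding A' C_def[symmetric] by (simp add: field_simps)
    finally show ?thesis by (simp add: e_def p_def)
  qed simp
  have "A' * \<delta> powr \<beta> \<le> A' * (1 / (8 * C))" using \<delta>(3) A'1 by (intro mult_left_mono) (auto simp: C_def)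
  also have "\<dots> = A / 2" using C unfolding A' C_def[symmetric] by simp
  finally have "A' * \<delta> powr \<beta> \<le> A / 2" .
  then have "norm (picard y0 y t) \<le> A * 2 powr (t / \<delta>)" if "t \<in> {0..T}" for t
    using A A'1 \<delta> inc that by (intro exp_growth[of "picard y0 y" A \<delta> A' t]) (auto simp: picard_0)
  then show ?thesis unfolding tempered_def using inc by auto
qed

text \<open>
  A fixed level sum is a finite sum of integrals that depend continuously on the values of the path
  at finitely many times, and on the class of tempered paths the level sums converge to the integral
  at a common rate. So pointwise convergence suffices.
\<close>

lemma picard_continuous:
  assumes w: "\<And>n. tempered \<delta> A A' (w n)" and y: "tempered \<delta> A A' y" and pos: "0 < \<delta>" "0 \<le> A" "0 \<le> A'"
    and conv: "\<And>t. t \<in> {0..T} \<Longrightarrow> (\<lambda>n. w n t) \<longlonglongrightarrow> y t" and b: "b \<in> {0..T}"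
  shows "(\<lambda>n. picard y0 (w n) b) \<longlonglongrightarrow> picard y0 y b"
proof (cases "b = 0")
  case False
  then have "0 < b" using b by simp
  define N where "N = A * 2 powr (T / \<delta>)"
  define M where "M = A' * 2 powr (T / \<delta>) + 2 * N / \<delta> powr \<beta>"
  have M: "0 \<le> M" using pos by (simp add: M_def N_def)
  note hb = tempered_holder_bounded[OF _ pos, folded N_def, folded M_def]
  have comp: "(\<lambda>n. path_integral (component_integrand F (w n) x i j) (\<lambda>t. x t $ j) 0 b)
      \<longlonglongrightarrow> path_integral (component_integrand F y x i j) (\<lambda>t. x t $ j) 0 b" for i j
  proof -
    interpret dyadic_rough_path "\<lambda>t. x t $ j" T \<alpha> H R \<beta>\<^sub>0 \<gamma> G by (rule driver)
    let ?f = "\<lambda>y. component_integrand F y x i j"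
    let ?g = "\<lambda>t. x t $ j"
    have level: "(\<lambda>n. level_sum (?f (w n)) ?g 0 b k) \<longlonglongrightarrow> level_sum (?f y) ?g 0 b k" if k: "1 \<le> k" for k
    proof -
      have eq: "level_sum (?f v) ?g 0 b k = running_sum (primitive (?f v)) ?g b k" for v
        using b T_le_1 k by (intro level_sum_eq_running_sum integrand_continuous) auto
      show ?thesis
        unfolding eq running_sum_def jump_sum_def
      proof (intro tendsto_sum)
        fix l assume l: "l \<in> {1..<2 * nat \<lfloor>b * 2 ^ (k - 1)\<rfloor>}"
        have "dyadic k (l + 1) \<le> T" using running_sum_dyadic_le[of b k l] b k l by auto
        moreover have "dyadic k (l - 1 + 1) \<le> dyadic k (l + 1)" by (rule dyadic_mono) simp
        ultimately have u: "avg ?g k l \<in> {-R..R}" "avg ?g k (l - 1) \<in> {-R..R}"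
          by (intro avg_range; linarith)+
        define s where "s = dyadic k l"
        have s: "s \<in> {0..T}" using \<open>dyadic k (l + 1) \<le> T\<close> dyadic_mono[of l "l + 1" k] by (simp add: s_def)
        let ?\<Delta> = "\<lambda>v. primitive (?f v) s (avg ?g k l) - primitive (?f v) s (avg ?g k (l - 1))"
        have "\<bar>?\<Delta> (w n) - ?\<Delta> y\<bar> \<le> L * norm (w n s - y s) powr \<theta> * \<bar>avg ?g k l - avg ?g k (l - 1)\<bar>" for n
          using integrand_holder[OF s s, of _ "w n" i j y]
          by (intro primitive_difference_bound[OF integrand_continuous integrand_continuous _ u] s) auto
        moreover have "(\<lambda>n. L * norm (w n s - y s) powr \<theta> * \<bar>avg ?g k l - avg ?g k (l - 1)\<bar>)
            \<longlonglongrightarrow> L * norm (y s - y s) powr \<theta> * \<bar>avg ?g k l - avg ?g k (l - 1)\<bar>"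
          using theta conv[OF s] by (intro tendsto_intros tendsto_powr2) auto
        ultimately have "(\<lambda>n. ?\<Delta> (w n) - ?\<Delta> y) \<longlonglongrightarrow> 0"
          by (intro Lim_null_comparison[of "\<lambda>n. ?\<Delta> (w n) - ?\<Delta> y"]) auto
        then show "(\<lambda>n. primitive (?f (w n)) (dyadic k l) (avg ?g k l) - primitive (?f (w n)) (dyadic k l) (avg ?g k (l - 1)))
           \<longlonglongrightarrow> primitive (?f y) (dyadic k l) (avg ?g k l) - primitive (?f y) (dyadic k l) (avg ?g k (l - 1))"
          unfolding s_def by (rule LIM_zero_cancel)
      qed
    qed
    let ?D = "\<lambda>k. (6 * (L * (1 + N)) * H + L * (1 + M powr \<theta>) * G) * tail_rate ^ k / (1 - tail_rate)"
    have "(\<lambda>k. tail_rate ^ k) \<longlonglongrightarrow> 0" using tail_rate by (intro LIMSEQ_power_zero) auto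
    then have "?D \<longlonglongrightarrow> (6 * (L * (1 + N)) * H + L * (1 + M powr \<theta>) * G) * 0 / (1 - tail_rate)"
      by (rule tendsto_divide[OF tendsto_mult_left tendsto_const]) (use tail_rate in auto)
    then have D: "?D \<longlonglongrightarrow> 0" by simp
    show ?thesis
    proof (rule limit_interchange[where K = "first_level b" and D = ?D])
      show "\<bar>level_sum (?f (w n)) ?g 0 b k - path_integral (?f (w n)) ?g 0 b\<bar> \<le> ?D k" if "first_level b \<le> k" for n k
        using component_integral(2)[OF hb[OF w] M b \<open>0 < b\<close> that] .
      show "\<bar>level_sum (?f y) ?g 0 b k - path_integral (?f y) ?g 0 b\<bar> \<le> ?D k" if "first_level b \<le> k" for k
        using component_integral(2)[OF hb[OF y] M b \<open>0 < b\<close> that] .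
      show "(\<lambda>n. level_sum (?f (w n)) ?g 0 b k) \<longlonglongrightarrow> level_sum (?f y) ?g 0 b k" if "first_level b \<le> k" for k
        using that by (intro level) (simp add: first_level_def)
    qed (rule D)
  qed
  show ?thesis
    unfolding picard_def vector_path_integral_def
    by (intro tendsto_add tendsto_const vec_tendstoI) (simp add: comp tendsto_sum)
qed (simp add: picard_0)

section \<open>Solutions of the delayed equation and their limit\<close>

text \<open>
  Time is shifted by \<open>\<epsilon>\<close>, with the initial value kept on \<open>{0..\<epsilon>}\<close>.
\<close>

definition delay :: "real \<Rightarrow> (real \<Rightarrow> real ^ 'm) \<Rightarrow> real \<Rightarrow> real ^ 'm" where
  "delay \<epsilon> y t = y (max 0 (t - \<epsilon>))"

lemma delay_tempered:
  assumes y: "tempered \<delta> A A' y" and pos: "0 < \<delta>" "0 \<le> A" "0 \<le> A'" "0 \<le> \<epsilon>"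
  shows "tempered \<delta> A A' (delay \<epsilon> y)"
  unfolding tempered_def delay_def
proof (intro conjI ballI impI)
  fix t assume t: "t \<in> {0..T}"
  have "norm (y (max 0 (t - \<epsilon>))) \<le> A * 2 powr (max 0 (t - \<epsilon>) / \<delta>)"
    using y t pos unfolding tempered_def by auto
  also have "\<dots> \<le> A * 2 powr (t / \<delta>)"
    using t pos by (intro mult_left_mono two_powr_mono) auto
  finally show "norm (y (max 0 (t - \<epsilon>))) \<le> A * 2 powr (t / \<delta>)" .
next
  fix a b assume ab: "a \<in> {0..T}" "b \<in> {0..T}" "a \<le> b" "b - a \<le> \<delta>"
  define a' b' where ab': "a' = max 0 (a - \<epsilon>)" "b' = max 0 (b - \<epsilon>)"
  have *: "a' \<in> {0..T}" "b' \<in> {0..T}" "a' \<le> b'" "b' - a' \<le> b - a" "b' \<le> b"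
    using ab pos by (auto simp: ab')
  then have "norm (y b' - y a') \<le> A' * 2 powr (b' / \<delta>) * (b' - a') powr \<beta>"
    using y ab(4) unfolding tempered_def by auto
  also have "\<dots> \<le> A' * 2 powr (b / \<delta>) * (b - a) powr \<beta>"
    using * pos beta by (intro mult_mono mult_left_mono two_powr_mono powr_mono2) auto
  finally show "norm (y (max 0 (b - \<epsilon>)) - y (max 0 (a - \<epsilon>))) \<le> A' * 2 powr (b / \<delta>) * (b - a) powr \<beta>"
    by (simp add: ab')
qed

definition tonelli :: "real ^ 'm \<Rightarrow> real \<Rightarrow> nat \<Rightarrow> real \<Rightarrow> real ^ 'm" where
  "tonelli y0 \<epsilon> k = ((\<lambda>y. picard y0 (delay \<epsilon> y)) ^^ k) (\<lambda>_. y0)"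

text \<open>
  The iterate number \<open>k + 1\<close> on \<open>{0..k * \<epsilon>}\<close> is determined by the iterate number \<open>k\<close> on
  \<open>{0..(k - 1) * \<epsilon>}\<close>. Hence every iteration extends the interval on which the sequence is constant by
  \<open>\<epsilon>\<close>, and after finitely many iterations the delayed equation is solved exactly.
\<close>

lemma tonelli_stabilises:
  assumes "0 \<le> \<epsilon>"
  shows "\<lbrakk>t \<in> {0..T}; t \<le> real k * \<epsilon>\<rbrakk> \<Longrightarrow> tonelli y0 \<epsilon> (Suc k) t = tonelli y0 \<epsilon> k t"
proof (induction k arbitrary: t)
  case 0
  then show ?case by (simp add: tonelli_def picard_0)
next
  case (Suc k)
  have unfold: "tonelli y0 \<epsilon> (Suc m) = picard y0 (delay \<epsilon> (tonelli y0 \<epsilon> m))" for m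
    by (simp add: tonelli_def)
  show ?case
    unfolding unfold[of "Suc k"] unfold[of k]
  proof (rule picard_cong[OF Suc.prems(1)])
    fix s assume "s \<in> {0..t}"
    then show "delay \<epsilon> (picard y0 (delay \<epsilon> (tonelli y0 \<epsilon> k))) s = delay \<epsilon> (tonelli y0 \<epsilon> k) s"
      unfolding delay_def[of \<epsilon> _ s] unfold[symmetric] using Suc.prems assms
      by (intro Suc.IH) (auto simp: algebra_simps)
  qed
qed

text \<open>
  The solutions \<open>Z n\<close> of the equations with delay \<open>1 / (n + 1)\<close> are uniformly bounded and
  equicontinuous, since they are all tempered with the same constants. A subsequence converges
  uniformly, the delayed paths converge to the same limit, and continuity of the integral operator
  shows that this limit is a fixed point.
\<close>

lemma solution_exists: "\<exists>y. is_solution F x y0 \<beta> T y"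
proof -
  define C where "C = increment_const"
  define A where "A = 1 + 2 * norm y0"
  define A' where "A' = 4 * C * A"
  define \<kappa> where "\<kappa> = \<theta> * \<beta> + \<gamma> - \<beta>"
  define \<delta> where "\<delta> = min ((1 / (4 * C)) powr (1 / \<kappa>)) ((1 / (8 * C)) powr (1 / \<beta>))"
  have C: "1 \<le> C" unfolding C_def by (rule increment_const)
  have \<kappa>: "0 < \<kappa>" using rates by (simp add: \<kappa>_def)
  have \<delta>: "0 < \<delta>" using C by (simp add: \<delta>_def)
  have \<delta>_powr: "\<delta> powr r \<le> z" if "\<delta> \<le> z powr (1 / r)" "0 < r" "0 < z" for r z
    using powr_mono2[of r \<delta> "z powr (1 / r)"] that \<delta> by (simp add: powr_powr)
  have small: "\<delta> powr \<kappa> \<le> 1 / (4 * C)" "\<delta> powr \<beta> \<le> 1 / (8 * C)"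
    using \<delta>_powr[of "1 / (4 * C)" \<kappa>] \<delta>_powr[of "1 / (8 * C)" \<beta>] C \<kappa> beta
    by (simp_all add: \<delta>_def)
  have A: "1 \<le> A" "2 * norm y0 \<le> A" by (simp_all add: A_def)
  have A': "0 \<le> A'" using C A by (simp add: A'_def)
  note pos = \<delta> order_trans[OF zero_le_one A(1)] A'
  have invariant: "tempered \<delta> A A' (picard y0 y)" if "tempered \<delta> A A' y" for y
    using picard_tempered[OF that A _ \<delta>] small by (simp add: A'_def C_def \<kappa>_def)
  have const: "tempered \<delta> A A' (\<lambda>_. y0)"
  proof -
    have "norm y0 \<le> A * 2 powr (t / \<delta>)" if "t \<in> {0..T}" for t
    proof -
      have "1 \<le> 2 powr (t / \<delta>)" using that \<delta> by (simp add: ge_one_powr_ge_zero)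
      then have "norm y0 * 1 \<le> A * 2 powr (t / \<delta>)" using A by (intro mult_mono) auto
      then show ?thesis by simp
    qed
    then show ?thesis using A' by (simp add: tempered_def)
  qed
  have tonelli: "tempered \<delta> A A' (tonelli y0 \<epsilon> k)" if "0 \<le> \<epsilon>" for \<epsilon> k
    using that by (induction k) (auto simp: tonelli_def intro!: const invariant delay_tempered pos)
  define \<epsilon> where "\<epsilon> n = 1 / real (Suc n)" for n
  define Z where "Z n = tonelli y0 (\<epsilon> n) (Suc n)" for n
  have \<epsilon>: "0 \<le> \<epsilon> n" for n by (simp add: \<epsilon>_def)
  have Z: "tempered \<delta> A A' (Z n)" for n unfolding Z_def by (intro tonelli \<epsilon>)
  \<comment> \<open>Since \<open>T \<le> 1\<close>, the first \<open>n + 1\<close> iterates with delay \<open>1 / (n + 1)\<close> reach the end of \<open>{0..T}\<close>.\<close>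
  have Z_eq: "picard y0 (delay (\<epsilon> n) (Z n)) t = Z n t" if "t \<in> {0..T}" for n t
    using tonelli_stabilises[OF \<epsilon>, of t "Suc n" n y0] that T_le_1 by (simp add: Z_def tonelli_def \<epsilon>_def)
  define N where "N = A * 2 powr (T / \<delta>)"
  define M where "M = A' * 2 powr (T / \<delta>) + 2 * N / \<delta> powr \<beta>"
  have M: "0 \<le> M" using pos by (simp add: M_def N_def)
  note hb = tempered_holder_bounded[OF _ pos, folded N_def, folded M_def]
  have lip: "norm (y s - y t) \<le> M * \<bar>s - t\<bar> powr \<beta>"
    if "tempered \<delta> A A' y" "s \<in> {0..T}" "t \<in> {0..T}" for y s t
    using hb[OF that(1)] that(2,3) unfolding holder_bounded_def by auto
  have modulus: "((\<lambda>h. M * \<bar>h\<bar> powr \<beta>) \<longlongrightarrow> 0) (nhds 0)"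
    using beta by (auto intro!: tendsto_eq_intros tendsto_powr2 filterlim_ident)
  obtain y r where "continuous_on {0..T} y" and r: "strict_mono (r :: nat \<Rightarrow> nat)"
    and unif: "\<And>e. 0 < e \<Longrightarrow> \<exists>n0. \<forall>n t. n0 \<le> n \<and> t \<in> {0..T} \<longrightarrow> norm (Z (r n) t - y t) < e"
  proof (rule Arzela_Ascoli[of "{0..T}" Z N])
    show "norm (Z n t) \<le> N" if "t \<in> {0..T}" for n t
      using hb[OF Z] that unfolding holder_bounded_def by blast
    fix s e :: real assume s: "s \<in> {0..T}" and e: "0 < e"
    have "\<forall>\<^sub>F h in nhds 0. M * \<bar>h\<bar> powr \<beta> < e"
      using order_tendstoD(2)[OF modulus e] .
    then obtain d where d: "0 < d" "\<And>h. \<bar>h\<bar> < d \<Longrightarrow> M * \<bar>h\<bar> powr \<beta> < e"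
      by (auto simp: eventually_nhds_metric dist_real_def)
    show "\<exists>d>0. \<forall>n t. t \<in> {0..T} \<and> norm (s - t) < d \<longrightarrow> norm (Z n s - Z n t) < e"
      using d s lip[OF Z s] by (intro exI[of _ d]) (auto intro: order_le_less_trans)
  qed auto
  have conv: "(\<lambda>n. Z (r n) t) \<longlonglongrightarrow> y t" if "t \<in> {0..T}" for t
    using unif that by (intro LIMSEQ_I) blast
  have y: "tempered \<delta> A A' y"
    unfolding tempered_def
  proof (intro conjI ballI impI)
    show "norm (y t) \<le> A * 2 powr (t / \<delta>)" if "t \<in> {0..T}" for t
      using Z that unfolding tempered_def
      by (intro LIMSEQ_le_const2[OF tendsto_norm[OF conv[OF that]]]) auto
    show "norm (y b - y a) \<le> A' * 2 powr (b / \<delta>) * (b - a) powr \<beta>"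
      if "a \<in> {0..T}" "b \<in> {0..T}" "a \<le> b" "b - a \<le> \<delta>" for a b
      using Z that unfolding tempered_def
      by (intro LIMSEQ_le_const2[OF tendsto_norm[OF tendsto_diff[OF conv[OF that(2)] conv[OF that(1)]]]]) auto
  qed
  have delayed: "(\<lambda>n. delay (\<epsilon> (r n)) (Z (r n)) t) \<longlonglongrightarrow> y t" if t: "t \<in> {0..T}" for t
  proof -
    have "(\<lambda>n. \<epsilon> (r n)) \<longlonglongrightarrow> 0"
      using LIMSEQ_subseq_LIMSEQ[OF lim_inverse_n' r]
        LIMSEQ_subseq_LIMSEQ[OF LIMSEQ_Suc[OF lim_inverse_n'] r] by (simp add: \<epsilon>_def o_def inverse_eq_divide)
    then have "(\<lambda>n. M * \<bar>\<epsilon> (r n)\<bar> powr \<beta>) \<longlonglongrightarrow> 0"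
      by (rule filterlim_compose[OF modulus])
    moreover have "norm (delay (\<epsilon> (r n)) (Z (r n)) t - Z (r n) t) \<le> M * \<bar>\<epsilon> (r n)\<bar> powr \<beta>" for n
    proof -
      have "norm (delay (\<epsilon> (r n)) (Z (r n)) t - Z (r n) t) \<le> M * \<bar>max 0 (t - \<epsilon> (r n)) - t\<bar> powr \<beta>"
        unfolding delay_def using t \<epsilon>[of "r n"] by (intro lip Z) auto
      also have "\<dots> \<le> M * \<bar>\<epsilon> (r n)\<bar> powr \<beta>"
        using M beta t \<epsilon>[of "r n"] by (intro mult_left_mono powr_mono2) auto
      finally show ?thesis .
    qed
    ultimately have "(\<lambda>n. delay (\<epsilon> (r n)) (Z (r n)) t - Z (r n) t) \<longlonglongrightarrow> 0"
      by (intro Lim_null_comparison[of "\<lambda>n. delay (\<epsilon> (r n)) (Z (r n)) t - Z (r n) t"]) auto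
    from tendsto_add[OF this conv[OF t]] show ?thesis by simp
  qed
  have "picard y0 y t = y t" if t: "t \<in> {0..T}" for t
  proof (rule LIMSEQ_unique)
    show "(\<lambda>n. picard y0 (delay (\<epsilon> (r n)) (Z (r n))) t) \<longlonglongrightarrow> picard y0 y t"
      by (rule picard_continuous[OF delay_tempered[OF Z pos \<epsilon>] y pos delayed t])
    show "(\<lambda>n. picard y0 (delay (\<epsilon> (r n)) (Z (r n))) t) \<longlonglongrightarrow> y t"
      using conv[OF t] t by (simp add: Z_eq)
  qed
  moreover have "y \<in> holder_class \<beta> T"
    unfolding holder_class_def by (intro CollectI exI[of _ M] ballI lip[OF y])
  ultimately have "is_solution F x y0 \<beta> T y"
    unfolding is_solution_def using tempered_integrable[OF y pos] by (auto simp: picard_def)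
  then show ?thesis by (intro exI[of _ y])
qed

end

section \<open>From the coefficients to the integral operator\<close>

lemma replace_coordinate_norm:
  fixes u v :: "real ^ 'd::finite"
  shows "norm ((\<chi> l. if l = j then \<xi> else u $ l) - (\<chi> l. if l = j then \<xi> else v $ l)) \<le> norm (u - v)"
  by (rule norm_le_componentwise_cart) simp

text \<open>
  One Hoelder constant, one range and one \<open>G\<close> serve for all coordinates, because norms dominate
  coordinates.
\<close>

lemma driver_dyadic_rough_path:
  fixes x :: "real \<Rightarrow> real ^ 'd::finite"
  assumes T: "0 \<le> T" "T \<le> 1" and \<alpha>: "0 < \<alpha>" and exps: "0 \<le> \<beta>\<^sub>0 + \<gamma>"
    and x: "x \<in> G_class \<beta>\<^sub>0 \<gamma> T" "x \<in> holder_class \<alpha> T"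
  obtains H R G where "\<And>j. dyadic_rough_path (\<lambda>t. x t $ j) T \<alpha> H R \<beta>\<^sub>0 \<gamma> G"
    and "\<And>s t. s \<in> {0..T} \<Longrightarrow> t \<in> {0..T} \<Longrightarrow> norm (x s - x t) \<le> H * \<bar>s - t\<bar> powr \<alpha>"
proof -
  obtain H0 where H0: "\<And>s t. s \<in> {0..T} \<Longrightarrow> t \<in> {0..T} \<Longrightarrow> norm (x s - x t) \<le> H0 * \<bar>s - t\<bar> powr \<alpha>"
    using x(2) unfolding holder_class_def by blast
  define H where "H = max H0 0"
  have H: "norm (x s - x t) \<le> H * \<bar>s - t\<bar> powr \<alpha>" if "s \<in> {0..T}" "t \<in> {0..T}" for s t
    using H0[OF that] mult_right_mono[of H0 H "\<bar>s - t\<bar> powr \<alpha>"] by (simp add: H_def)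
  define R where "R = norm (x 0) + H"
  have R: "norm (x t) \<le> R" if t: "t \<in> {0..T}" for t
  proof -
    have "H * \<bar>t - 0\<bar> powr \<alpha> \<le> H * 1"
      using t T \<alpha> by (intro mult_left_mono powr_le1) (auto simp: H_def)
    then show ?thesis
      using H[of t 0] t T norm_triangle_ineq2[of "x t" "x 0"] by (simp add: R_def)
  qed
  have "G_norm \<beta>\<^sub>0 \<gamma> T x < \<infinity>" using x(1) by (simp add: G_class_def)
  then obtain G where G: "0 \<le> G" "G_norm \<beta>\<^sub>0 \<gamma> T x = ennreal G"
    by (cases "G_norm \<beta>\<^sub>0 \<gamma> T x") auto
  have "dyadic_rough_path (\<lambda>t. x t $ j) T \<alpha> H R \<beta>\<^sub>0 \<gamma> G" for j
  proof (unfold_locales)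
    fix s t assume "s \<in> {0..T}" "t \<in> {0..T}"
    from H[OF this] show "\<bar>x s $ j - x t $ j\<bar> \<le> H * \<bar>s - t\<bar> powr \<alpha>"
      using component_le_norm_cart[of "x s - x t" j] by simp
  next
    fix t assume "t \<in> {0..T}"
    from R[OF this] show "\<bar>x t $ j\<bar> \<le> R" using component_le_norm_cart[of "x t" j] by simp
  next
    fix a b n assume ab: "0 \<le> a" "a < b" "b \<le> T"
    show "(\<Sum>k\<in>{first_level (b - a)..<first_level (b - a) + n}.
        2 powr (- (real (k + 1) * \<beta>\<^sub>0)) * dyadic_variation (\<lambda>t. x t $ j) a b k) \<le> G * (b - a) powr (\<beta>\<^sub>0 + \<gamma>)"
      by (rule G_norm_variation[OF _ G(1) ab]) (simp add: G(2))
  qed (use T \<alpha> exps G in \<open>auto simp: H_def\<close>)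
  then show ?thesis
    using H that[of H R G] by simp
qed

text \<open>
  It remains to check the hypotheses on the component integrands. The \<open>j\<close>-th coordinate of the
  driver stays in the compact set \<open>{-R..R}\<close>, and there the local Hoelder bound of \<open>F\<close> holds with
  one constant. It gives the regularity directly, and linear growth by comparison with the value at
  time \<open>0\<close> and state \<open>0\<close>, which is bounded by compactness.
\<close>

theorem theorem3p1:
  fixes F :: "real \<Rightarrow> real ^ 'm::finite \<Rightarrow> real ^ 'd::finite \<Rightarrow> real ^ 'd ^ 'm"
    and \<alpha> \<beta> \<beta>\<^sub>0 \<gamma> \<theta> T :: real
  assumes "0 < \<beta>" and "\<beta> \<le> \<alpha>" and "\<alpha> \<le> 1"
    and "0 < \<theta>" and "\<theta> \<le> 1"
    and "0 \<le> T" and "T \<le> 1"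
    and "\<And>i j. continuous_on ({0..} \<times> UNIV \<times> UNIV) (\<lambda>(t, y, x). F t y x $ i $ j)"
    and "\<And>i j. holder_except \<theta> j (\<lambda>t y x. F t y x $ i $ j)"
    and "\<gamma> > 0" and "0 < \<beta> - \<gamma>" and "\<beta> - \<gamma> < \<beta>\<^sub>0" and "\<beta>\<^sub>0 < \<theta> * \<beta>"
  shows "\<forall>x \<in> G_class \<beta>\<^sub>0 \<gamma> T \<inter> holder_class \<alpha> T. \<forall>y\<^sub>0. \<exists>y. is_solution F x y\<^sub>0 \<beta> T y"
proof (intro ballI allI)
  fix x :: "real \<Rightarrow> real ^ 'd" and y\<^sub>0 :: "real ^ 'm"
  assume x: "x \<in> G_class \<beta>\<^sub>0 \<gamma> T \<inter> holder_class \<alpha> T"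
  note cont = assms(8) and hold = assms(9)
  obtain H R G where driver: "\<And>j. dyadic_rough_path (\<lambda>t. x t $ j) T \<alpha> H R \<beta>\<^sub>0 \<gamma> G"
    and H: "\<And>s t. s \<in> {0..T} \<Longrightarrow> t \<in> {0..T} \<Longrightarrow> norm (x s - x t) \<le> H * \<bar>s - t\<bar> powr \<alpha>"
    using driver_dyadic_rough_path[of T \<alpha> \<beta>\<^sub>0 \<gamma> x] x assms by auto
  have H0: "0 \<le> H" using driver by (auto simp: dyadic_rough_path_def holder_path_def)
  define X where "X j t \<xi> = (\<chi> l. if l = j then \<xi> else x t $ l)" for j t \<xi>
  have component: "component_integrand F y x i j t \<xi> = F t (y t) (X j t \<xi>) $ i $ j" for y i j t \<xi>
    by (simp add: component_integrand_def X_def)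
  have X_dist: "norm (X j s \<xi> - X j t \<xi>) \<le> H * \<bar>s - t\<bar> powr \<alpha>" if "s \<in> {0..T}" "t \<in> {0..T}" for j s t \<xi>
    using replace_coordinate_norm[of j \<xi> "x s" "x t"] H[OF that] by (simp add: X_def)
  have X_cont: "continuous_on UNIV (X j t)" for j t
  proof -
    have "continuous_on UNIV (\<lambda>\<xi>. if l = j then \<xi> else x t $ l)" for l
      by (cases "l = j") auto
    then show ?thesis unfolding X_def by (rule continuous_on_vec_lambda)
  qed
  have F_cont: "continuous_on UNIV (\<lambda>\<xi>. F t v (X j t \<xi>) $ i $ j)" if "0 \<le> t" for t v i j
  proof -
    have "continuous_on UNIV ((\<lambda>(t, y, x). F t y x $ i $ j) \<circ> (\<lambda>\<xi>. (t, v, X j t \<xi>)))"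
      by (intro continuous_on_compose continuous_on_Pair continuous_on_const X_cont
          continuous_on_subset[OF cont]) (use that in auto)
    then show ?thesis by (simp add: o_def)
  qed
  define Q where "Q i j L \<longleftrightarrow> (\<forall>t\<in>{0..1}. \<forall>t'\<in>{0..1}. \<forall>v v' x x'. x $ j = x' $ j \<and> x $ j \<in> {-R..R} \<longrightarrow>
      \<bar>F t v x $ i $ j - F t' v' x' $ i $ j\<bar>
        \<le> L * (\<bar>t - t'\<bar> powr \<theta> + norm (v - v') powr \<theta> + norm (x - x') powr \<theta>))" for i j L
  have "\<exists>L. Q i j L" for i j
    unfolding Q_def by (rule mp[OF spec[OF hold[of j i, unfolded holder_except_def]] compact_Icc])
  then obtain l where "\<And>i j. Q i j (l i j)" by metis
  then have l: "\<bar>F t v x $ i $ j - F t' v' x' $ i $ j\<bar>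
        \<le> l i j * (\<bar>t - t'\<bar> powr \<theta> + norm (v - v') powr \<theta> + norm (x - x') powr \<theta>)"
    if "t \<in> {0..1}" "t' \<in> {0..1}" "x $ j = x' $ j" "x $ j \<in> {-R..R}" for i j t t' v v' x x'
    using that unfolding Q_def by blast
  define P where "P i j B \<longleftrightarrow> (\<forall>\<xi>\<in>{-R..R}. \<bar>F 0 0 (X j 0 \<xi>) $ i $ j\<bar> \<le> B)" for i j B
  have "\<exists>B. P i j B" for i j
  proof -
    have "compact ((\<lambda>\<xi>. F 0 0 (X j 0 \<xi>) $ i $ j) ` {-R..R})"
      by (intro compact_continuous_image continuous_on_subset[OF F_cont]) auto
    from compact_imp_bounded[OF this] show ?thesis by (auto simp: bounded_iff P_def)
  qed
  then obtain B where "\<And>i j. P i j (B i j)" by metis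
  then have B: "\<bar>F 0 0 (X j 0 \<xi>) $ i $ j\<bar> \<le> B i j" if "\<xi> \<in> {-R..R}" for i j \<xi>
    using that unfolding P_def by blast
  define l1 where "l1 = (\<Sum>i\<in>UNIV. \<Sum>j\<in>UNIV. \<bar>l i j\<bar>)"
  define B1 where "B1 = (\<Sum>i\<in>UNIV. \<Sum>j\<in>UNIV. \<bar>B i j\<bar>)"
  have double_sum: "\<bar>c i j\<bar> \<le> (\<Sum>i\<in>UNIV. \<Sum>j\<in>UNIV. \<bar>c i j\<bar>)" for c :: "'m \<Rightarrow> 'd \<Rightarrow> real" and i j
  proof -
    have "\<bar>c i j\<bar> \<le> (\<Sum>j\<in>UNIV. \<bar>c i j\<bar>)" by (intro member_le_sum) auto
    also have "\<dots> \<le> (\<Sum>i\<in>UNIV. \<Sum>j\<in>UNIV. \<bar>c i j\<bar>)" by (intro member_le_sum) (auto intro: sum_nonneg)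
    finally show ?thesis .
  qed
  have l1: "0 \<le> l1" "l i j \<le> l1" and B1: "0 \<le> B1" "B i j \<le> B1" for i j
    using double_sum[of l i j] double_sum[of B i j]
    by (auto simp: l1_def B1_def intro!: sum_nonneg)
  define L where "L = 1 + B1 + l1 * (2 + H powr \<theta>)"
  have L: "1 \<le> L" "l1 * (1 + H powr \<theta>) \<le> L" "l1 \<le> L" "B1 + l1 * (2 + H powr \<theta>) \<le> L"
    using l1(1) B1(1) by (auto simp: L_def algebra_simps)
  have holder: "\<bar>F s v (X j s \<xi>) $ i $ j - F t v' (X j t \<xi>) $ i $ j\<bar>
      \<le> l1 * ((1 + H powr \<theta>) * \<bar>s - t\<bar> powr (\<theta> * \<beta>) + norm (v - v') powr \<theta>)"
    if st: "s \<in> {0..T}" "t \<in> {0..T}" and \<xi>: "\<xi> \<in> {-R..R}" for s t v v' i j \<xi>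
  proof -
    have abs1: "\<bar>s - t\<bar> \<le> 1" using st assms(7) by auto
    have p1: "\<bar>s - t\<bar> powr \<theta> \<le> \<bar>s - t\<bar> powr (\<theta> * \<beta>)"
      using abs1 assms(1-5) by (intro powr_mono') (auto simp: mult_le_cancel_left1)
    have "norm (X j s \<xi> - X j t \<xi>) powr \<theta> \<le> (H * \<bar>s - t\<bar> powr \<alpha>) powr \<theta>"
      using X_dist[OF st] assms(4) by (intro powr_mono2) auto
    also have "\<dots> = H powr \<theta> * \<bar>s - t\<bar> powr (\<alpha> * \<theta>)"
      using H0 by (simp add: powr_mult powr_powr)
    also have "\<dots> \<le> H powr \<theta> * \<bar>s - t\<bar> powr (\<theta> * \<beta>)"
      using abs1 assms(1-5) by (intro mult_left_mono powr_mono') (auto simp: mult.commute)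
    finally have p2: "norm (X j s \<xi> - X j t \<xi>) powr \<theta> \<le> H powr \<theta> * \<bar>s - t\<bar> powr (\<theta> * \<beta>)" .
    have "\<bar>F s v (X j s \<xi>) $ i $ j - F t v' (X j t \<xi>) $ i $ j\<bar>
      \<le> l i j * (\<bar>s - t\<bar> powr \<theta> + norm (v - v') powr \<theta> + norm (X j s \<xi> - X j t \<xi>) powr \<theta>)"
      using st \<xi> assms(7) by (intro l) (auto simp: X_def)
    also have "\<dots> \<le> l1 * (\<bar>s - t\<bar> powr \<theta> + norm (v - v') powr \<theta> + norm (X j s \<xi> - X j t \<xi>) powr \<theta>)"
      by (intro mult_right_mono l1) auto
    also have "\<dots> \<le> l1 * ((1 + H powr \<theta>) * \<bar>s - t\<bar> powr (\<theta> * \<beta>) + norm (v - v') powr \<theta>)"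
      using p1 p2 l1(1) by (intro mult_left_mono) (auto simp: distrib_right)
    finally show ?thesis .
  qed
  interpret rough_system F x T \<alpha> H R \<beta>\<^sub>0 \<gamma> G \<beta> \<theta> L
  proof (intro rough_system.intro driver)
    fix y :: "real \<Rightarrow> real ^ 'm" and i j t \<xi> assume t: "t \<in> {0..T}" and \<xi>: "\<xi> \<in> {-R..R}"
    have "t powr (\<theta> * \<beta>) \<le> 1" using t assms by (intro powr_le1) auto
    then have "(1 + H powr \<theta>) * t powr (\<theta> * \<beta>) \<le> (1 + H powr \<theta>) * 1" by (intro mult_left_mono) auto
    moreover have "norm (y t) powr \<theta> \<le> 1 + norm (y t)"
    proof -
      have "norm (y t) powr \<theta> \<le> (1 + norm (y t)) powr \<theta>" using assms(4) by (intro powr_mono2) auto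
      also have "\<dots> \<le> (1 + norm (y t)) powr 1" using assms(5) by (intro powr_mono) auto
      finally show ?thesis by simp
    qed
    ultimately have "(1 + H powr \<theta>) * \<bar>t - 0\<bar> powr (\<theta> * \<beta>) + norm (y t - 0) powr \<theta> \<le> 2 + H powr \<theta> + norm (y t)"
      using t by simp
    then have "l1 * ((1 + H powr \<theta>) * \<bar>t - 0\<bar> powr (\<theta> * \<beta>) + norm (y t - 0) powr \<theta>) \<le> l1 * (2 + H powr \<theta> + norm (y t))"
      by (rule mult_left_mono) (rule l1)
    moreover have "B1 + l1 * (2 + H powr \<theta> + norm (y t)) \<le> L * (1 + norm (y t))"
      using L(4) mult_right_mono[OF L(3), of "norm (y t)"] by (simp add: algebra_simps)
    ultimately show "\<bar>component_integrand F y x i j t \<xi>\<bar> \<le> L * (1 + norm (y t))"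
      using holder[where s = t and t = 0 and v = "y t" and v' = 0 and i = i and j = j, OF t _ \<xi>] B[OF \<xi>, where i = i and j = j] B1(2)[where i = i and j = j] assms(6)
      unfolding component by auto
  next
    fix y y' :: "real \<Rightarrow> real ^ 'm" and i j s t \<xi>
    assume st: "s \<in> {0..T}" "t \<in> {0..T}" and \<xi>: "\<xi> \<in> {-R..R}"
    have "l1 * ((1 + H powr \<theta>) * \<bar>s - t\<bar> powr (\<theta> * \<beta>) + norm (y s - y' t) powr \<theta>)
        \<le> L * \<bar>s - t\<bar> powr (\<theta> * \<beta>) + L * norm (y s - y' t) powr \<theta>"
      using mult_right_mono[OF L(2), of "\<bar>s - t\<bar> powr (\<theta> * \<beta>)"]
        mult_right_mono[OF L(3), of "norm (y s - y' t) powr \<theta>"]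
      by (simp add: algebra_simps)
    then show "\<bar>component_integrand F y x i j s \<xi> - component_integrand F y' x i j t \<xi>\<bar>
           \<le> L * (\<bar>s - t\<bar> powr (\<theta> * \<beta>) + norm (y s - y' t) powr \<theta>)"
      using holder[where v = "y s" and v' = "y' t" and i = i and j = j, OF st \<xi>] unfolding component by (simp add: distrib_left)
  next
    fix y :: "real \<Rightarrow> real ^ 'm" and i j t assume "t \<in> {0..T}"
    then show "continuous_on UNIV (component_integrand F y x i j t)"
      unfolding component using F_cont[of t "y t" j i] by simp
  qed (use assms L in auto)
  show "\<exists>y. is_solution F x y\<^sub>0 \<beta> T y" by (rule solution_exists)
qed

end
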